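(* Let $C_1,C_2\in(0,\infty)$ be absolute constants (fixed once and for all) and let $1<p<2$. Then there are constants $c_1(p),c_2(p)\in(0,\infty)$ depending only on $p$ (with $C_1,C_2$ being fixed) such that the following holds. Let $n\in\mathbb{N}$, $z=\big((n/i)^{1/p}\big)_{i=1}^n$, $d_1\geq\dots\geq d_n>0$ and $a_1\geq\dots\geq a_n>0$. For $k=1,\dots,n$ let $c^k=(a_k,\dots,a_k,0,\dots,0)\in\mathbb{R}^n$ be the vector with $c^k_i=a_k$ for $i\leq n/k$ and $c^k_i=0$ for $i>n/k$. Let $M_d$ be an Orlicz function related to $d$ (in the sense defined in the context), and assume that for all $x\in\mathbb{R}^n$ $$\bigg\| \bigg(\Big(\frac{1}{k}\sum_{i=1}^k|x_i^*|^p \Big)^{1/p}\bigg)_{k=1}^n \bigg\|_{M_d,a} \leq C_1 \,\|x\|_{M_d,a}$$ and $$\bigg\| \bigg(\Big(\frac{1}{k}\sum_{i=k+1}^n|x_i^*|^2 \Big)^{1/2}\bigg)_{k=1}^n \bigg\|_{M_d,a} \leq C_2\, \|x\|_{M_d,a}.$$ Then, for all $x\in\mathbb{R}^n$, $$c_1(p)\,\|x\|_{M_d,a} \leq \frac{1}{(n!)^3}\sum_{\pi,\sigma,\eta\in\mathfrak{S}_n} \bigg( \sum_{i,k=1}^n \big|x_i\, c^k_{\pi(i)}\, d_{\sigma(k)}\, z_{\eta(k)} \big|^2 \bigg)^{1/2} \leq c_2(p)\, \|x\|_{M_d,a}.$$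
   Context: $\mathfrak{S}_n$ is the group of permutations of $\{1,\dots,n\}$. For $x\in\mathbb{R}^n$, $(x_i^* )_{i=1}^n$ denotes the non-increasing rearrangement of $(|x_i|)_{i=1}^n$. An Orlicz function is a convex function $M:[0,\infty)\to[0,\infty)$ with $M(0)=0$ and $M(t)>0$ for $t>0$; it is assumed throughout that $\lim_{t\to0}M(t)/t=0$ and $\lim_{t\to\infty}M(t)/t=\infty$. Its conjugate is the Orlicz function $M^*(x)=\sup_{t\geq0}(xt-M(t))$, and $(M^* )^{-1}$ denotes the inverse function of $M^*$. For an Orlicz function $M$ and weights $a_1\geq\dots\geq a_n\geq0$, the Orlicz-Lorentz norm on $\mathbb{R}^n$ is $$\|x\|_{M,a}=\inf\Big\{\rho>0:\ \sum_{i=1}^n M\Big(\frac{a_ix_i^*}{\rho}\Big)\leq1\Big\}.$$ Orlicz function related to $d$: given $1<p<2$ and $d_1\geq\dots\geq d_n>0$, $M_d$ denotes an Orlicz function such that for all $\ell=1,\dots,n$ $$(M_d^* )^{-1}\Big(\frac{\ell}{n}\Big)\approx \frac1n\sum_{i=1}^{\ell}d_i+\Big(\frac{\ell}{n}\Big)^{1/p^*}\Big(\frac1n\sum_{i=\ell+1}^n d_i^{\,p}\Big)^{1/p},$$ where $\frac1p+\frac1{p^*}=1$ and $\approx$ means two-sided inequality up to positive absolute constants (fixed once and for all, in particular independent of $n$, $d$, $a$ and $\ell$). It is known that such an Orlicz function exists. *)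

theory Defs
  imports "HOL-Analysis.Analysis" "HOL-Combinatorics.Permutations"
begin

text \<open>
  A vector of \<open>\<real>\<^sup>n\<close> is a function \<open>nat \<Rightarrow> real\<close> of which only the values on \<open>{1..n}\<close> matter:
  the constants of the main result must not depend on \<open>n\<close>, so \<open>n\<close> cannot be a type.
  Likewise, only the values on \<open>[0, \<infinity>)\<close> of an Orlicz function \<open>real \<Rightarrow> real\<close> matter.
\<close>

text \<open>Non-increasing rearrangement of \<open>|x 1|, \<dots>, |x n|\<close>; meaningful for \<open>1 \<le> i \<le> n\<close>.\<close>

definition rearr :: "nat \<Rightarrow> (nat \<Rightarrow> real) \<Rightarrow> nat \<Rightarrow> real" where
  "rearr n x i = rev (sort (map (\<lambda>j. \<bar>x j\<bar>) [1..<Suc n])) ! (i - 1)"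

text \<open>The two limits are the usual standing assumptions on Orlicz functions.\<close>

definition orlicz_function :: "(real \<Rightarrow> real) \<Rightarrow> bool" where
  "orlicz_function M \<longleftrightarrow>
     convex_on {0..} M \<and> M 0 = 0 \<and> (\<forall>t>0. M t > 0) \<and>
     ((\<lambda>t. M t / t) \<longlongrightarrow> 0) (at_right 0) \<and>
     filterlim (\<lambda>t. M t / t) at_top at_top"

text \<open>
  For an Orlicz function the supremum is finite when \<open>x \<ge> 0\<close>, and the conjugate is a bijection
  of \<open>[0, \<infinity>)\<close> onto itself, both because of the limits above.
\<close>

definition orlicz_conj :: "(real \<Rightarrow> real) \<Rightarrow> real \<Rightarrow> real" where
  "orlicz_conj M x = (SUP t\<in>{0..}. x * t - M t)"

definition orlicz_conj_inv :: "(real \<Rightarrow> real) \<Rightarrow> real \<Rightarrow> real" where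
  "orlicz_conj_inv M = the_inv_into {0..} (orlicz_conj M)"

definition orlicz_lorentz_norm ::
    "nat \<Rightarrow> (real \<Rightarrow> real) \<Rightarrow> (nat \<Rightarrow> real) \<Rightarrow> (nat \<Rightarrow> real) \<Rightarrow> real" where
  "orlicz_lorentz_norm n M a x =
     Inf {\<rho>. \<rho> > 0 \<and> (\<Sum>i=1..n. M (a i * rearr n x i / \<rho>)) \<le> 1}"

text \<open>The exponent \<open>p\<^sup>*\<close> with \<open>1/p + 1/p\<^sup>* = 1\<close>, for \<open>p > 1\<close>.\<close>

definition conj_exponent :: "real \<Rightarrow> real" where
  "conj_exponent p = p / (p - 1)"

text \<open>
  \<open>M\<close> is an Orlicz function related to \<open>d\<close>; \<open>A\<close> and \<open>B\<close> are the lower and upper constants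
  hidden in the equivalence \<open>\<approx>\<close>.
\<close>

definition orlicz_related ::
    "real \<Rightarrow> real \<Rightarrow> real \<Rightarrow> nat \<Rightarrow> (nat \<Rightarrow> real) \<Rightarrow> (real \<Rightarrow> real) \<Rightarrow> bool" where
  "orlicz_related A B p n d M \<longleftrightarrow>
     orlicz_function M \<and>
     (\<forall>l\<in>{1..n}.
        let r = (1 / real n) * (\<Sum>i=1..l. d i) +
                (real l / real n) powr (1 / conj_exponent p) *
                  ((1 / real n) * (\<Sum>i=l+1..n. d i powr p)) powr (1 / p)
        in A * r \<le> orlicz_conj_inv M (real l / real n) \<and>
           orlicz_conj_inv M (real l / real n) \<le> B * r)"

definition zvec :: "real \<Rightarrow> nat \<Rightarrow> nat \<Rightarrow> real" where
  "zvec p n i = (real n / real i) powr (1 / p)"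

text \<open>\<open>cvec n a k\<close> is the vector \<open>c\<^sup>k\<close>.\<close>

definition cvec :: "nat \<Rightarrow> (nat \<Rightarrow> real) \<Rightarrow> nat \<Rightarrow> nat \<Rightarrow> real" where
  "cvec n a k i = (if real i \<le> real n / real k then a k else 0)"

definition perm_average ::
    "real \<Rightarrow> nat \<Rightarrow> (nat \<Rightarrow> real) \<Rightarrow> (nat \<Rightarrow> real) \<Rightarrow> (nat \<Rightarrow> real) \<Rightarrow> real" where
  "perm_average p n d a x =
     (1 / (fact n) ^ 3) *
     (\<Sum>\<pi> | \<pi> permutes {1..n}. \<Sum>\<sigma> | \<sigma> permutes {1..n}. \<Sum>\<eta> | \<eta> permutes {1..n}.
        sqrt (\<Sum>i=1..n. \<Sum>k=1..n.
          \<bar>x i * cvec n a k (\<pi> i) * d (\<sigma> k) * zvec p n (\<eta> k)\<bar>\<^sup>2))"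

end

theory Submission
  imports Defs
begin

text \<open>
  Write \<open>b\<^sub>k(\<pi>) = a\<^sub>k (\<Sum>\<^sub>i x\<^sub>i\<^sup>2 [\<pi> i \<le> n/k])\<^sup>1\<^sup>/\<^sup>2\<close>, so that the average is that of the
  \<open>\<ell>\<^sub>2\<close>-norms of \<open>(b\<^sub>k(\<pi>) d\<^bsub>\<sigma>(k)\<^esub> z\<^bsub>\<eta>(k)\<^esub>)\<close>. The average over \<open>\<sigma>\<close> of the \<open>\<ell>\<^sub>q\<close>-norm of
  \<open>(b\<^sub>k d\<^bsub>\<sigma>(k)\<^esub>)\<close> is comparable to the \<open>\<rho>\<close> with \<open>\<Sum>\<^sub>k F(b\<^sub>k/\<rho>) = 1\<close>, where \<open>F(t)\<close> is the mean over \<open>j\<close>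
  of \<open>\<phi>(t d\<^sub>j)\<close> and \<open>\<phi>(s)\<close> equals \<open>s\<^sup>q\<close> up to \<open>1\<close> and \<open>s\<close> beyond. For \<open>q = 2\<close> and the weights \<open>z\<close> one
  has \<open>F(t) \<approx> t\<^sup>p\<close>, so averaging over \<open>\<eta>\<close> produces the \<open>\<ell>\<^sub>p\<close>-norm. For \<open>q = p\<close> and the weights \<open>d\<close> the
  functions \<open>F\<close> and \<open>M\<^sub>d\<close> agree, up to constants, on values between \<open>1/n\<close> and \<open>1\<close>, so averaging over
  \<open>\<sigma>\<close> then produces the Orlicz norm. It remains to average over \<open>\<pi>\<close>: from below, pull the mean
  inside the norm and use \<open>E b\<^sub>k \<ge> c a\<^sub>k x\<^sub>k\<^sup>*\<close>; from above, use Jensen to replace \<open>b\<^sub>k\<close> by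
  \<open>(E b\<^sub>k\<^sup>p)\<^sup>1\<^sup>/\<^sup>p\<close>, which is bounded by the two vectors of the hypotheses.
\<close>

section \<open>Averages over permutations\<close>

definition perm_mean :: "nat \<Rightarrow> ((nat \<Rightarrow> nat) \<Rightarrow> real) \<Rightarrow> real" where
  "perm_mean n f = (\<Sum>\<sigma> | \<sigma> permutes {1..n}. f \<sigma>) / fact n"

lemma card_permutes_atLeastAtMost: "card {\<sigma>. \<sigma> permutes {1..n::nat}} = fact n"
  by (rule card_permutations) auto

lemma perm_mean_mono:
  assumes "\<And>\<sigma>. \<sigma> permutes {1..n} \<Longrightarrow> f \<sigma> \<le> g \<sigma>"
  shows "perm_mean n f \<le> perm_mean n g"
  unfolding perm_mean_def using assms by (intro divide_right_mono sum_mono) auto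

lemma perm_mean_cong:
  assumes "\<And>\<sigma>. \<sigma> permutes {1..n} \<Longrightarrow> f \<sigma> = g \<sigma>"
  shows "perm_mean n f = perm_mean n g"
  unfolding perm_mean_def using assms by simp

lemma perm_mean_nonneg:
  assumes "\<And>\<sigma>. \<sigma> permutes {1..n} \<Longrightarrow> 0 \<le> f \<sigma>"
  shows "0 \<le> perm_mean n f"
  unfolding perm_mean_def using assms by (intro divide_nonneg_nonneg sum_nonneg) auto

lemma perm_mean_const [simp]: "perm_mean n (\<lambda>\<sigma>. c) = c"
  using card_permutes_atLeastAtMost[of n] by (simp add: perm_mean_def)

lemma perm_mean_add: "perm_mean n (\<lambda>\<sigma>. f \<sigma> + g \<sigma>) = perm_mean n f + perm_mean n g"
  by (simp add: perm_mean_def sum.distrib add_divide_distrib)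

lemma perm_mean_diff: "perm_mean n (\<lambda>\<sigma>. f \<sigma> - g \<sigma>) = perm_mean n f - perm_mean n g"
  by (simp add: perm_mean_def sum_subtractf diff_divide_distrib)

lemma perm_mean_cmult: "perm_mean n (\<lambda>\<sigma>. c * f \<sigma>) = c * perm_mean n f"
  by (simp add: perm_mean_def sum_distrib_left)

lemma perm_mean_sum: "perm_mean n (\<lambda>\<sigma>. \<Sum>k\<in>K. f k \<sigma>) = (\<Sum>k\<in>K. perm_mean n (f k))"
  unfolding perm_mean_def by (subst sum.swap) (simp add: sum_divide_distrib)

lemma perm_mean_swap:
  "perm_mean n (\<lambda>\<sigma>. perm_mean n (\<lambda>\<pi>. f \<sigma> \<pi>)) = perm_mean n (\<lambda>\<pi>. perm_mean n (\<lambda>\<sigma>. f \<sigma> \<pi>))"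
  unfolding perm_mean_def sum_divide_distrib[symmetric] by (subst sum.swap) simp

lemma perm_mean_compose_right:
  assumes "\<tau> permutes {1..n}"
  shows "perm_mean n (\<lambda>\<sigma>. f (\<sigma> \<circ> \<tau>)) = perm_mean n f"
  unfolding perm_mean_def using sum_permutations_compose_right[OF assms, of f] by simp

lemma sum_permutes_apply:
  fixes f :: "nat \<Rightarrow> real"
  assumes "\<sigma> permutes {1..n}"
  shows "(\<Sum>k=1..n. f (\<sigma> k)) = (\<Sum>j=1..n. f j)"
  using sum.permute[OF assms, of f] by (simp add: o_def)

text \<open>Composing with a transposition shows that all positions have the same mean, and the sum
  over the positions does not depend on \<open>\<sigma>\<close>.\<close>

lemma perm_mean_apply:
  assumes k: "k \<in> {1..n}"
  shows "perm_mean n (\<lambda>\<sigma>. f (\<sigma> k)) = (\<Sum>j=1..n. f j) / n"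
proof -
  have eq: "perm_mean n (\<lambda>\<sigma>. f (\<sigma> l)) = perm_mean n (\<lambda>\<sigma>. f (\<sigma> k))" if "l \<in> {1..n}" for l
    using perm_mean_compose_right[OF permutes_swap_id[OF k that], of "\<lambda>\<sigma>. f (\<sigma> k)"] by simp
  have "n * perm_mean n (\<lambda>\<sigma>. f (\<sigma> k)) = (\<Sum>l=1..n. perm_mean n (\<lambda>\<sigma>. f (\<sigma> l)))"
    using eq by simp
  also have "\<dots> = perm_mean n (\<lambda>\<sigma>. \<Sum>l=1..n. f (\<sigma> l))"
    by (simp add: perm_mean_sum)
  also have "\<dots> = (\<Sum>j=1..n. f j)"
    by (subst perm_mean_cong[OF sum_permutes_apply]) simp_all
  finally show ?thesis using k by (simp add: field_simps)
qed

text \<open>Near independence of two entries. With \<open>l\<close> fixed, the \<open>n - 1\<close>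
  positions other than \<open>l\<close> give the same mean, and their sum is at most the total of
  \<open>f\<close> times \<open>g (\<sigma> l)\<close>. The factor 2 absorbs
  \<open>n / (n - 1)\<close>.\<close>

lemma perm_mean_apply2_le:
  assumes k: "k \<in> {1..n}" and l: "l \<in> {1..n}" and "k \<noteq> l"
    and f: "\<And>j. j \<in> {1..n} \<Longrightarrow> 0 \<le> f j" and g: "\<And>j. j \<in> {1..n} \<Longrightarrow> 0 \<le> g j"
  shows "perm_mean n (\<lambda>\<sigma>. f (\<sigma> k) * g (\<sigma> l)) \<le> 2 * ((\<Sum>j=1..n. f j) / n) * ((\<Sum>j=1..n. g j) / n)"
proof -
  define D where "D = perm_mean n (\<lambda>\<sigma>. f (\<sigma> k) * g (\<sigma> l))"
  let ?F = "\<Sum>j=1..n. f j" and ?G = "\<Sum>j=1..n. g j"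
  have n: "n \<ge> 2" using k l \<open>k \<noteq> l\<close> by auto
  have eq: "perm_mean n (\<lambda>\<sigma>. f (\<sigma> m) * g (\<sigma> l)) = D" if "m \<in> {1..n} - {l}" for m
    using perm_mean_compose_right[OF permutes_swap_id[OF k, of m], of "\<lambda>\<sigma>. f (\<sigma> k) * g (\<sigma> l)"]
      that \<open>k \<noteq> l\<close> by (simp add: D_def)
  have "real (n - 1) * D = (\<Sum>m\<in>{1..n}-{l}. perm_mean n (\<lambda>\<sigma>. f (\<sigma> m) * g (\<sigma> l)))"
    using eq l by simp
  also have "\<dots> = perm_mean n (\<lambda>\<sigma>. \<Sum>m\<in>{1..n}-{l}. f (\<sigma> m) * g (\<sigma> l))"
    by (simp add: perm_mean_sum)
  also have "\<dots> \<le> perm_mean n (\<lambda>\<sigma>. ?F * g (\<sigma> l))"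
  proof (rule perm_mean_mono)
    fix \<sigma> assume \<sigma>: "\<sigma> permutes {1..n}"
    have in_range: "\<sigma> j \<in> {1..n}" if "j \<in> {1..n}" for j
      using permutes_in_image[OF \<sigma>] that by blast
    have "(\<Sum>m\<in>{1..n}-{l}. f (\<sigma> m) * g (\<sigma> l)) \<le> (\<Sum>m\<in>{1..n}. f (\<sigma> m) * g (\<sigma> l))"
      using in_range l f g by (intro sum_mono2) (auto intro!: mult_nonneg_nonneg simp del: atLeastAtMost_iff)
    also have "\<dots> = ?F * g (\<sigma> l)"
      using sum_permutes_apply[OF \<sigma>, of f] by (simp add: sum_distrib_right[symmetric])
    finally show "(\<Sum>m\<in>{1..n}-{l}. f (\<sigma> m) * g (\<sigma> l)) \<le> ?F * g (\<sigma> l)" .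
  qed
  also have "\<dots> = ?F * (?G / n)"
    using perm_mean_apply[OF l, of g] by (simp add: perm_mean_cmult)
  finally have *: "real (n - 1) * D \<le> ?F * (?G / n)" .
  have "D \<ge> 0" unfolding D_def
    using permutes_in_image[of _ "{1..n}"] k l
    by (intro perm_mean_nonneg mult_nonneg_nonneg f g) metis+
  hence "real n * D \<le> 2 * (real (n - 1) * D)"
    using n by (simp add: algebra_simps mult_left_mono)
  also have "\<dots> \<le> 2 * (?F * (?G / n))" using * by simp
  finally show ?thesis using n by (simp add: D_def field_simps)
qed

text \<open>The power mean inequality. Young's inequality for \<open>f \<sigma>\<close> and
  \<open>m powr (q - 1)\<close>, with \<open>m\<close> the mean of \<open>f\<close>, is averaged;
  \<open>m powr q\<close> then occurs on both sides and is absorbed.\<close>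

lemma perm_mean_le_powr:
  assumes q: "q \<ge> 1" and f: "\<And>\<sigma>. \<sigma> permutes {1..n} \<Longrightarrow> 0 \<le> f \<sigma>"
  shows "perm_mean n f \<le> perm_mean n (\<lambda>\<sigma>. f \<sigma> powr q) powr (1 / q)"
proof -
  define m where "m = perm_mean n f"
  have "m \<ge> 0" unfolding m_def using f by (rule perm_mean_nonneg)
  have young: "f \<sigma> * m powr (q - 1) \<le> (1 / q) * f \<sigma> powr q + (1 - 1 / q) * m powr q"
    if "\<sigma> permutes {1..n}" for \<sigma>
    using Youngs_inequality_0[of "1 / q" "1 - 1 / q" "f \<sigma> powr q" "m powr q"] q f[OF that] \<open>m \<ge> 0\<close>
    by (cases "f \<sigma> = 0 \<or> m = 0") (auto simp: powr_powr right_diff_distrib)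
  have "m powr q = m * m powr (q - 1)"
    using \<open>m \<ge> 0\<close> by (cases "m = 0") (auto simp: powr_mult_base)
  also have "\<dots> = perm_mean n (\<lambda>\<sigma>. m powr (q - 1) * f \<sigma>)"
    by (simp add: perm_mean_cmult m_def)
  also have "\<dots> \<le> perm_mean n (\<lambda>\<sigma>. (1 / q) * f \<sigma> powr q + (1 - 1 / q) * m powr q)"
    using young by (intro perm_mean_mono) (simp add: mult.commute)
  also have "\<dots> = (1 / q) * perm_mean n (\<lambda>\<sigma>. f \<sigma> powr q) + (1 - 1 / q) * m powr q"
    by (simp only: perm_mean_add perm_mean_cmult perm_mean_const)
  finally have "m powr q \<le> perm_mean n (\<lambda>\<sigma>. f \<sigma> powr q)"
    using q by (simp add: field_simps)
  hence "(m powr q) powr (1 / q) \<le> perm_mean n (\<lambda>\<sigma>. f \<sigma> powr q) powr (1 / q)"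
    using q by (intro powr_mono2) auto
  thus ?thesis using q \<open>m \<ge> 0\<close> by (simp add: powr_powr m_def)
qed

lemma perm_average_eq_perm_mean:
  "perm_average p n d a x = perm_mean n (\<lambda>\<pi>. perm_mean n (\<lambda>\<sigma>. perm_mean n (\<lambda>\<eta>.
     sqrt (\<Sum>i=1..n. \<Sum>k=1..n. \<bar>x i * cvec n a k (\<pi> i) * d (\<sigma> k) * zvec p n (\<eta> k)\<bar>\<^sup>2))))"
  by (simp add: perm_average_def perm_mean_def sum_divide_distrib[symmetric] power3_eq_cube)

section \<open>Subadditivity of powers with exponent at most 1\<close>

lemma powr_add_le_add_powr:
  fixes u v s :: real
  assumes "0 \<le> u" "0 \<le> v" "0 < s" "s \<le> 1"
  shows "(u + v) powr s \<le> u powr s + v powr s"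
proof (cases "u + v = 0")
  case False
  hence pos: "u + v > 0" using assms by simp
  \<comment> \<open>Both fractions lie in \<open>[0, 1]\<close>, where lowering the exponent from 1
    to \<open>s\<close> can only increase the power.\<close>
  have "1 = u / (u + v) + v / (u + v)"
    using pos by (simp add: add_divide_distrib[symmetric])
  also have "\<dots> \<le> (u / (u + v)) powr s + (v / (u + v)) powr s"
    using assms pos powr_mono'[of s 1 "u / (u+v)"] powr_mono'[of s 1 "v / (u+v)"]
    by (intro add_mono) auto
  also have "\<dots> = (u powr s + v powr s) / (u + v) powr s"
    using assms by (simp add: powr_divide add_divide_distrib)
  finally show ?thesis using pos by (simp add: field_simps)
qed (use assms in simp)

lemma powr_sum_le_sum_powr:
  fixes s :: real
  assumes "\<And>i. i \<in> I \<Longrightarrow> 0 \<le> f i" "0 < s" "s \<le> 1"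
  shows "(\<Sum>i\<in>I. f i) powr s \<le> (\<Sum>i\<in>I. f i powr s)"
  using assms(1)
proof (induction I rule: infinite_finite_induct)
  case (insert i I)
  have "(f i + (\<Sum>j\<in>I. f j)) powr s \<le> f i powr s + (\<Sum>j\<in>I. f j) powr s"
    using insert.prems assms by (intro powr_add_le_add_powr sum_nonneg) auto
  thus ?case using insert by fastforce
qed auto

section \<open>Averages of lq norms of randomly permuted weights\<close>

text \<open>For \<open>q \<ge> 1\<close> and \<open>s \<ge> 0\<close> this is the minimum of
  \<open>s\<close> and \<open>s powr q\<close>, so either of the two may serve as an upper
  bound.\<close>

definition trunc_pow :: "real \<Rightarrow> real \<Rightarrow> real" where
  "trunc_pow q s = (if s \<le> 1 then s powr q else s)"

definition trunc_mean :: "real \<Rightarrow> nat \<Rightarrow> (nat \<Rightarrow> real) \<Rightarrow> real \<Rightarrow> real" where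
  "trunc_mean q n d t = (\<Sum>j=1..n. trunc_pow q (t * d j)) / n"

lemma trunc_pow_nonneg: "0 \<le> s \<Longrightarrow> 0 \<le> trunc_pow q s"
  by (simp add: trunc_pow_def)

lemma trunc_pow_le_self: "q \<ge> 1 \<Longrightarrow> 0 \<le> s \<Longrightarrow> trunc_pow q s \<le> s"
  using powr_mono'[of 1 q s] by (simp add: trunc_pow_def)

lemma trunc_pow_le_powr: "q \<ge> 1 \<Longrightarrow> 0 \<le> s \<Longrightarrow> trunc_pow q s \<le> s powr q"
  using powr_mono[of 1 q s] by (simp add: trunc_pow_def)

lemma trunc_pow_ge_1: "1 \<le> s \<Longrightarrow> 1 \<le> trunc_pow q s"
  by (simp add: trunc_pow_def)

lemma le_1_plus_trunc_pow: "s \<le> 1 + trunc_pow q s"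
  by (auto simp: trunc_pow_def add_increasing2)

lemma trunc_pow_mono: "q \<ge> 1 \<Longrightarrow> 0 \<le> s \<Longrightarrow> s \<le> t \<Longrightarrow> trunc_pow q s \<le> trunc_pow q t"
  using powr_mono2[of q s t] powr_le1[of q s] by (auto simp: trunc_pow_def)

lemma trunc_mean_nonneg:
  assumes "0 \<le> t" "\<And>j. j \<in> {1..n} \<Longrightarrow> 0 \<le> d j"
  shows "0 \<le> trunc_mean q n d t"
  unfolding trunc_mean_def using assms
  by (intro divide_nonneg_nonneg sum_nonneg trunc_pow_nonneg mult_nonneg_nonneg) auto

lemma trunc_mean_mono:
  assumes "q \<ge> 1" "0 \<le> s" "s \<le> t" "\<And>j. j \<in> {1..n} \<Longrightarrow> 0 \<le> d j"
  shows "trunc_mean q n d s \<le> trunc_mean q n d t"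
  unfolding trunc_mean_def using assms
  by (intro divide_right_mono sum_mono trunc_pow_mono mult_nonneg_nonneg mult_right_mono) auto

text \<open>The entries up to 1 have norm \<open>s powr (1 / q) \<le> 1 + s\<close>, with
  \<open>s\<close> the sum of their powers; for the entries above 1 the lq norm is at most the l1
  norm.\<close>

lemma lq_norm_le_sum_trunc_pow:
  assumes "finite I" and w: "\<And>i. i \<in> I \<Longrightarrow> 0 \<le> w i" and q: "q \<ge> 1"
  shows "(\<Sum>i\<in>I. w i powr q) powr (1 / q) \<le> 1 + (\<Sum>i\<in>I. trunc_pow q (w i))"
proof -
  let ?S = "{i \<in> I. w i \<le> 1}" and ?L = "{i \<in> I. \<not> w i \<le> 1}"
  have split: "(\<Sum>i\<in>I. f i) = (\<Sum>i\<in>?S. f i) + (\<Sum>i\<in>?L. f i)" for f :: "_ \<Rightarrow> real"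
    using \<open>finite I\<close> by (subst sum.union_disjoint[symmetric]) (auto intro: sum.cong)
  define s where "s = (\<Sum>i\<in>?S. w i powr q)"
  have "s \<ge> 0" unfolding s_def by (simp add: sum_nonneg)
  have "(\<Sum>i\<in>I. w i powr q) powr (1 / q) \<le> s powr (1 / q) + (\<Sum>i\<in>?L. w i powr q) powr (1 / q)"
    unfolding split[of "\<lambda>i. w i powr q"] s_def using q
    by (intro powr_add_le_add_powr sum_nonneg) auto
  also have "(\<Sum>i\<in>?L. w i powr q) powr (1 / q) \<le> (\<Sum>i\<in>?L. (w i powr q) powr (1 / q))"
    using q by (intro powr_sum_le_sum_powr) auto
  also have "\<dots> = (\<Sum>i\<in>?L. trunc_pow q (w i))"
    using q w by (intro sum.cong) (auto simp: powr_powr trunc_pow_def)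
  also have "s powr (1 / q) \<le> 1 + s"
    using \<open>s \<ge> 0\<close> q powr_mono[of "1 / q" 1 s] powr_le1[of "1 / q" s] by (cases "s \<le> 1") auto
  also have "s = (\<Sum>i\<in>?S. trunc_pow q (w i))"
    unfolding s_def by (intro sum.cong) (auto simp: trunc_pow_def)
  finally show ?thesis unfolding split[of "\<lambda>i. trunc_pow q (w i)"] by linarith
qed

text \<open>Every entry is at most the norm \<open>S\<close>. If \<open>S \<ge> 1\<close>, this
  gives the estimate entry by entry, in the form
  \<open>trunc_pow q (w i) \<le> S * min (w i powr q) 1\<close>. If \<open>S < 1\<close>, all
  entries are below 1 and the left-hand side is \<open>S powr q \<le> S\<close>.\<close>

lemma sum_trunc_pow_le_lq_norm:
  assumes "finite I" and w: "\<And>i. i \<in> I \<Longrightarrow> 0 \<le> w i" and q: "q \<ge> 1"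
  shows "(\<Sum>i\<in>I. trunc_pow q (w i))
    \<le> (\<Sum>i\<in>I. w i powr q) powr (1 / q) * (1 + (\<Sum>i\<in>I. min (w i powr q) 1))"
proof -
  define S where "S = (\<Sum>i\<in>I. w i powr q) powr (1 / q)"
  define T where "T = (\<Sum>i\<in>I. min (w i powr q) 1)"
  have "S \<ge> 0" by (simp add: S_def)
  have "T \<ge> 0" unfolding T_def by (intro sum_nonneg) auto
  have wS: "w i \<le> S" if "i \<in> I" for i
  proof -
    have "(w i powr q) powr (1 / q) \<le> S"
      unfolding S_def using that q \<open>finite I\<close> by (intro powr_mono2 member_le_sum) auto
    thus ?thesis using w[OF that] q by (simp add: powr_powr)
  qed
  have Sq: "S powr q = (\<Sum>i\<in>I. w i powr q)"
    using q by (simp add: S_def powr_powr sum_nonneg)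
  show ?thesis
  proof (cases "S \<ge> 1")
    case True
    have "(\<Sum>i\<in>I. trunc_pow q (w i)) \<le> (\<Sum>i\<in>I. S * min (w i powr q) 1)"
    proof (rule sum_mono)
      fix i assume i: "i \<in> I"
      show "trunc_pow q (w i) \<le> S * min (w i powr q) 1"
      proof (cases "w i \<le> 1")
        case le: True
        hence "w i powr q \<le> 1" using w[OF i] q powr_le1[of q "w i"] by simp
        moreover have "1 * w i powr q \<le> S * w i powr q" using True by (intro mult_right_mono) auto
        ultimately show ?thesis using le by (simp add: trunc_pow_def min_def)
      next
        case False
        hence "w i powr q \<ge> 1" using q by (simp add: ge_one_powr_ge_zero)
        thus ?thesis using wS[OF i] False by (simp add: trunc_pow_def min_def)
      qed
    qed
    also have "\<dots> = S * T" by (simp add: T_def sum_distrib_left)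
    also have "\<dots> \<le> S * (1 + T)" using \<open>S \<ge> 0\<close> by (intro mult_left_mono) auto
    finally show ?thesis by (simp add: S_def T_def)
  next
    case False
    hence "(\<Sum>i\<in>I. trunc_pow q (w i)) = (\<Sum>i\<in>I. w i powr q)"
      using wS by (intro sum.cong) (force simp: trunc_pow_def)+
    also have "\<dots> = S powr q" by (simp add: Sq)
    also have "\<dots> \<le> S" using powr_mono'[of 1 q S] q False \<open>S \<ge> 0\<close> by simp
    also have "\<dots> \<le> S * (1 + T)" using \<open>S \<ge> 0\<close> \<open>T \<ge> 0\<close> by (simp add: algebra_simps)
    finally show ?thesis by (simp add: S_def T_def)
  qed
qed

section \<open>Two-sided estimate of the mean lq norm\<close>

context
  fixes n :: nat and q :: real and b d :: "nat \<Rightarrow> real"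
  assumes q: "q \<ge> 1"
    and b: "\<And>k. k \<in> {1..n} \<Longrightarrow> 0 \<le> b k" and d: "\<And>k. k \<in> {1..n} \<Longrightarrow> 0 \<le> d k"
begin

lemma perm_nonneg:
  assumes "\<sigma> permutes {1..n}" "k \<in> {1..n}" "l \<in> {1..n}"
  shows "0 \<le> b l * d (\<sigma> k)"
  using assms permutes_in_image[OF assms(1), of k] by (intro mult_nonneg_nonneg b d) blast+

lemma perm_mean_sum_trunc_pow:
  "perm_mean n (\<lambda>\<sigma>. \<Sum>k=1..n. trunc_pow q (b k * d (\<sigma> k))) = (\<Sum>k=1..n. trunc_mean q n d (b k))"
  unfolding perm_mean_sum
  by (intro sum.cong) (simp_all add: perm_mean_apply[where f = "\<lambda>j. trunc_pow q (b _ * d j)"] trunc_mean_def)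

lemma perm_mean_lq_norm_le:
  "perm_mean n (\<lambda>\<sigma>. (\<Sum>k=1..n. (b k * d (\<sigma> k)) powr q) powr (1 / q))
    \<le> 1 + (\<Sum>k=1..n. trunc_mean q n d (b k))"
proof -
  have "perm_mean n (\<lambda>\<sigma>. (\<Sum>k=1..n. (b k * d (\<sigma> k)) powr q) powr (1 / q))
    \<le> perm_mean n (\<lambda>\<sigma>. 1 + (\<Sum>k=1..n. trunc_pow q (b k * d (\<sigma> k))))"
    using q perm_nonneg by (intro perm_mean_mono lq_norm_le_sum_trunc_pow) auto
  thus ?thesis by (simp only: perm_mean_add perm_mean_const perm_mean_sum_trunc_pow)
qed

text \<open>
  With \<open>Y\<close> and \<open>T\<close> the sums of \<open>trunc_pow q\<close> and of \<open>min (_ powr q) 1\<close>, the norm \<open>S\<close> satisfies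
  \<open>Y \<le> S (1 + T)\<close>. Linearising \<open>1 / (1 + T) \<ge> 2 c - c\<^sup>2 (1 + T)\<close> reduces the lower bound to the
  second moment \<open>E (Y T)\<close>, which is controlled because distinct entries are almost independent.
\<close>

lemma perm_mean_lq_norm_ge:
  defines "Y \<equiv> \<Sum>k=1..n. trunc_mean q n d (b k)"
  shows "Y / (2 * (1 + Y))
    \<le> perm_mean n (\<lambda>\<sigma>. (\<Sum>k=1..n. (b k * d (\<sigma> k)) powr q) powr (1 / q))"
proof -
  define f where "f k j = trunc_pow q (b k * d j)" for k j
  define g where "g k j = min ((b k * d j) powr q) 1" for k j
  define F where "F k = (\<Sum>j=1..n. f k j) / n" for k
  define G where "G k = (\<Sum>j=1..n. g k j) / n" for k
  define Z where "Z = (\<Sum>k=1..n. G k)"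
  define S where "S \<sigma> = (\<Sum>k=1..n. (b k * d (\<sigma> k)) powr q) powr (1 / q)" for \<sigma>
  have Y: "Y = (\<Sum>k=1..n. F k)" by (simp add: Y_def F_def f_def trunc_mean_def)
  have f0: "0 \<le> f k j" if "k \<in> {1..n}" "j \<in> {1..n}" for k j
    unfolding f_def using that by (intro trunc_pow_nonneg mult_nonneg_nonneg b d)
  have g0: "0 \<le> g k j" and g1: "g k j \<le> 1" for k j
    unfolding g_def by auto
  have gf: "g k j \<le> f k j" for k j
    unfolding f_def g_def trunc_pow_def by auto
  have F0: "0 \<le> F k" if "k \<in> {1..n}" for k
    unfolding F_def using that f0 by (intro divide_nonneg_nonneg sum_nonneg) auto
  have G0: "0 \<le> G k" for k
    unfolding G_def using g0 by (intro divide_nonneg_nonneg sum_nonneg) auto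
  have "0 \<le> Z" unfolding Z_def using G0 by (intro sum_nonneg) auto
  have "Z \<le> Y" unfolding Z_def Y F_def G_def using gf by (intro sum_mono divide_right_mono) auto
  have "0 \<le> Y" using \<open>0 \<le> Z\<close> \<open>Z \<le> Y\<close> by simp
  have mf: "perm_mean n (\<lambda>\<sigma>. \<Sum>k=1..n. f k (\<sigma> k)) = Y"
    unfolding perm_mean_sum Y F_def by (intro sum.cong perm_mean_apply) auto
  \<comment> \<open>On the diagonal, \<open>g \<le> 1\<close> leaves the mean of \<open>f\<close>;
    off the diagonal, the two entries are almost independent.\<close>
  have pair: "perm_mean n (\<lambda>\<sigma>. f k (\<sigma> k) * g l (\<sigma> l)) \<le> (if l = k then F k else 0) + 2 * F k * G l"
    if k: "k \<in> {1..n}" and l: "l \<in> {1..n}" for k l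
  proof (cases "l = k")
    case True
    have "perm_mean n (\<lambda>\<sigma>. f k (\<sigma> k) * g k (\<sigma> k)) \<le> perm_mean n (\<lambda>\<sigma>. f k (\<sigma> k))"
    proof (rule perm_mean_mono)
      fix \<sigma> assume "\<sigma> permutes {1..n}"
      hence "0 \<le> f k (\<sigma> k)" using k permutes_in_image[of \<sigma> "{1..n}" k] by (intro f0) simp_all
      thus "f k (\<sigma> k) * g k (\<sigma> k) \<le> f k (\<sigma> k)"
        using g1[of k "\<sigma> k"] mult_left_le by blast
    qed
    also have "\<dots> = F k" unfolding F_def by (rule perm_mean_apply[OF k])
    finally show ?thesis using True F0[OF k] G0[of k] by (simp add: add_increasing2)
  next
    case False
    thus ?thesis
      unfolding F_def G_def using perm_mean_apply2_le[of k n l "f k" "g l"] k l f0[OF k] g0 by auto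
  qed
  have mfg: "perm_mean n (\<lambda>\<sigma>. (\<Sum>k=1..n. f k (\<sigma> k)) * (\<Sum>l=1..n. g l (\<sigma> l))) \<le> Y + 2 * Y * Z"
  proof -
    have "perm_mean n (\<lambda>\<sigma>. (\<Sum>k=1..n. f k (\<sigma> k)) * (\<Sum>l=1..n. g l (\<sigma> l)))
      = (\<Sum>k=1..n. \<Sum>l=1..n. perm_mean n (\<lambda>\<sigma>. f k (\<sigma> k) * g l (\<sigma> l)))"
      by (simp add: sum_product perm_mean_sum)
    also have "\<dots> \<le> (\<Sum>k=1..n. \<Sum>l=1..n. (if l = k then F k else 0) + 2 * F k * G l)"
      using pair by (intro sum_mono) auto
    also have "\<dots> = (\<Sum>k=1..n. F k + 2 * F k * Z)"
      by (intro sum.cong) (auto simp: sum.distrib Z_def sum_distrib_left)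
    also have "\<dots> = Y + 2 * Y * Z"
      by (simp add: sum.distrib Y sum_distrib_left sum_distrib_right)
    finally show ?thesis .
  qed
  \<comment> \<open>This \<open>c\<close> maximises
    \<open>2 * c * Y - c\<^sup>2 * (2 * Y + 2 * Y * Z)\<close>, the lower bound that averaging
    produces; the value there is \<open>Y * c\<close>.\<close>
  define c where "c = 1 / (2 * (1 + Z))"
  have cZ: "c * (1 + Z) = 1 / 2" and "c > 0" using \<open>0 \<le> Z\<close> by (simp_all add: c_def field_simps)
  have point: "2 * c * (\<Sum>k=1..n. f k (\<sigma> k))
      - c\<^sup>2 * ((\<Sum>k=1..n. f k (\<sigma> k)) + (\<Sum>k=1..n. f k (\<sigma> k)) * (\<Sum>l=1..n. g l (\<sigma> l))) \<le> S \<sigma>"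
    if \<sigma>: "\<sigma> permutes {1..n}" for \<sigma>
  proof -
    define y where "y = (\<Sum>k=1..n. f k (\<sigma> k))"
    define u where "u = 1 + (\<Sum>l=1..n. g l (\<sigma> l))"
    have y0: "0 \<le> y" unfolding y_def using permutes_in_image[OF \<sigma>] by (intro sum_nonneg f0) auto
    have u1: "1 \<le> u" unfolding u_def using g0 by (simp add: sum_nonneg)
    have "y \<le> S \<sigma> * u"
      using sum_trunc_pow_le_lq_norm[of "{1..n}" "\<lambda>k. b k * d (\<sigma> k)" q] perm_nonneg[OF \<sigma>] q
      by (simp add: y_def u_def S_def f_def g_def)
    hence "y / u \<le> S \<sigma>" using u1 by (simp add: field_simps)
    moreover have "2 * c - c\<^sup>2 * u \<le> 1 / u"
    proof -
      have "0 \<le> (1 - c * u)\<^sup>2" by simp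
      hence "u * (2 * c - c\<^sup>2 * u) \<le> 1" by (simp add: power2_eq_square algebra_simps)
      thus ?thesis using u1 by (simp add: field_simps)
    qed
    hence "y * (2 * c - c\<^sup>2 * u) \<le> y * (1 / u)" using y0 by (rule mult_left_mono)
    ultimately have "y * (2 * c - c\<^sup>2 * u) \<le> S \<sigma>" by simp
    thus ?thesis by (simp add: y_def u_def algebra_simps)
  qed
  have "Y / (2 * (1 + Y)) \<le> Y / (2 * (1 + Z))"
    using \<open>0 \<le> Z\<close> \<open>Z \<le> Y\<close> \<open>0 \<le> Y\<close> by (intro divide_left_mono) auto
  also have "\<dots> = Y * c"
    by (simp add: c_def)
  also have "\<dots> = Y * (2 * c - 2 * c * (c * (1 + Z)))"
    unfolding cZ by simp
  also have "\<dots> = 2 * c * Y - c\<^sup>2 * (Y + (Y + 2 * Y * Z))"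
    by (simp add: power2_eq_square algebra_simps)
  also have "\<dots> \<le> 2 * c * Y - c\<^sup>2 * (Y + perm_mean n (\<lambda>\<sigma>. (\<Sum>k=1..n. f k (\<sigma> k)) * (\<Sum>l=1..n. g l (\<sigma> l))))"
    using mfg by (intro diff_left_mono mult_left_mono add_left_mono) auto
  also have "\<dots> = perm_mean n (\<lambda>\<sigma>. 2 * c * (\<Sum>k=1..n. f k (\<sigma> k))
      - c\<^sup>2 * ((\<Sum>k=1..n. f k (\<sigma> k)) + (\<Sum>k=1..n. f k (\<sigma> k)) * (\<Sum>l=1..n. g l (\<sigma> l))))"
    by (simp only: perm_mean_diff perm_mean_cmult perm_mean_add mf)
  also have "\<dots> \<le> perm_mean n S"
    using point by (rule perm_mean_mono)
  finally show ?thesis by (simp add: S_def[abs_def])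
qed

end

section \<open>The weights z\<close>

lemma sqrt_sum_squares_eq_powr:
  fixes w :: "'a \<Rightarrow> real"
  assumes "\<And>i. i \<in> I \<Longrightarrow> 0 \<le> w i"
  shows "sqrt (\<Sum>i\<in>I. (w i)\<^sup>2) = (\<Sum>i\<in>I. w i powr 2) powr (1 / 2)"
proof -
  have "(\<Sum>i\<in>I. w i powr 2) = (\<Sum>i\<in>I. (w i)\<^sup>2)"
    using assms by (intro sum.cong) simp_all
  thus ?thesis by (simp add: powr_half_sqrt sum_nonneg)
qed

lemma lq_norm_scale:
  fixes w :: "'a \<Rightarrow> real"
  assumes "\<tau> > 0" "q \<ge> 1" "\<And>i. i \<in> I \<Longrightarrow> 0 \<le> w i"
  shows "(\<Sum>i\<in>I. w i powr q) powr (1 / q) = \<tau> * (\<Sum>i\<in>I. (w i / \<tau>) powr q) powr (1 / q)"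
proof -
  have "(\<Sum>i\<in>I. (w i / \<tau>) powr q) = (\<Sum>i\<in>I. w i powr q) / \<tau> powr q"
    unfolding sum_divide_distrib using assms by (intro sum.cong) (auto simp: powr_divide)
  thus ?thesis using assms by (simp add: powr_divide powr_powr sum_nonneg)
qed

context
  fixes n :: nat and q \<tau> :: real and b d :: "nat \<Rightarrow> real"
  assumes q: "q \<ge> 1" and \<tau>: "\<tau> > 0"
    and b: "\<And>k. k \<in> {1..n} \<Longrightarrow> 0 \<le> b k" and d: "\<And>k. k \<in> {1..n} \<Longrightarrow> 0 \<le> d k"
begin

lemma perm_mean_lq_norm_scale:
  "perm_mean n (\<lambda>\<sigma>. (\<Sum>k=1..n. (b k * d (\<sigma> k)) powr q) powr (1 / q))
    = \<tau> * perm_mean n (\<lambda>\<sigma>. (\<Sum>k=1..n. (b k / \<tau> * d (\<sigma> k)) powr q) powr (1 / q))"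
  unfolding perm_mean_cmult[symmetric]
proof (rule perm_mean_cong)
  fix \<sigma> assume \<sigma>: "\<sigma> permutes {1..n}"
  have nn: "0 \<le> b k * d (\<sigma> k)" if "k \<in> {1..n}" for k
    using that permutes_in_image[OF \<sigma>, of k] by (intro mult_nonneg_nonneg b d) simp_all
  show "(\<Sum>k=1..n. (b k * d (\<sigma> k)) powr q) powr (1 / q)
    = \<tau> * (\<Sum>k=1..n. (b k / \<tau> * d (\<sigma> k)) powr q) powr (1 / q)"
    using lq_norm_scale[OF \<tau> q, of "{1..n}" "\<lambda>k. b k * d (\<sigma> k)"] nn by simp
qed

lemma perm_mean_lq_norm_le_scaled:
  "perm_mean n (\<lambda>\<sigma>. (\<Sum>k=1..n. (b k * d (\<sigma> k)) powr q) powr (1 / q))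
    \<le> \<tau> * (1 + (\<Sum>k=1..n. trunc_mean q n d (b k / \<tau>)))"
  unfolding perm_mean_lq_norm_scale using b d \<tau>
  by (intro mult_left_mono perm_mean_lq_norm_le[OF q]) simp_all

lemma perm_mean_lq_norm_ge_scaled:
  assumes "1 / 2 \<le> (\<Sum>k=1..n. trunc_mean q n d (b k / \<tau>))"
  shows "\<tau> / 6 \<le> perm_mean n (\<lambda>\<sigma>. (\<Sum>k=1..n. (b k * d (\<sigma> k)) powr q) powr (1 / q))"
proof -
  define Y where "Y = (\<Sum>k=1..n. trunc_mean q n d (b k / \<tau>))"
  have "1 / 2 \<le> Y" using assms by (simp add: Y_def)
  \<comment> \<open>The quotient \<open>Y / (2 * (1 + Y))\<close> increases with \<open>Y\<close>
    and equals \<open>1 / 6\<close> at \<open>Y = 1 / 2\<close>.\<close>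
  hence "1 / 6 \<le> Y / (2 * (1 + Y))" by (simp add: field_simps)
  also have "\<dots> \<le> perm_mean n (\<lambda>\<sigma>. (\<Sum>k=1..n. (b k / \<tau> * d (\<sigma> k)) powr q) powr (1 / q))"
    unfolding Y_def using b d \<tau> by (intro perm_mean_lq_norm_ge[OF q]) simp_all
  finally show ?thesis unfolding perm_mean_lq_norm_scale using \<tau> by (simp add: field_simps)
qed

end

section \<open>Integral bounds for power sums\<close>

lemma sum_powr_minus_le:
  assumes "0 < \<alpha>" "\<alpha> < 1"
  shows "(\<Sum>i=1..N. real i powr - \<alpha>) \<le> real N powr (1 - \<alpha>) / (1 - \<alpha>)"
proof (induction N)
  case (Suc N)
  let ?s = "1 - \<alpha>" and ?x = "real (Suc N)"
  \<comment> \<open>The weighted mean inequality for \<open>N\<close> and \<open>Suc N\<close>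
    replaces the comparison with an integral: multiplied by \<open>?x powr - \<alpha>\<close>, it
    bounds the new summand by an increment of the antiderivative.\<close>
  have "real N powr ?s * ?x powr (1 - ?s) \<le> ?s * real N + (1 - ?s) * ?x"
    using Youngs_inequality_0[of ?s "1 - ?s" "real N" ?x] assms by (cases "N = 0") auto
  also have "\<dots> = ?x - ?s" by (simp add: algebra_simps)
  finally have "real N powr ?s * ?x powr \<alpha> * ?x powr - \<alpha> \<le> (?x - ?s) * ?x powr - \<alpha>"
    by (intro mult_right_mono) simp_all
  hence "?s * ?x powr - \<alpha> \<le> ?x powr ?s - real N powr ?s"
    by (simp add: mult.assoc powr_add[symmetric] left_diff_distrib powr_mult_base del: of_nat_Suc)
  hence "?x powr - \<alpha> \<le> ?x powr ?s / ?s - real N powr ?s / ?s"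
    using assms
    by (simp add: diff_divide_distrib[symmetric] pos_le_divide_eq mult.commute del: of_nat_Suc)
  with Suc show ?case by simp
qed (use assms in simp)

text \<open>Increment bound that lets tail sums telescope. It follows from
  \<open>1 + y \<le> exp y\<close> and \<open>ln (1 - 1 / x) \<le> - 1 / x\<close>.\<close>

lemma powr_minus_le_diff:
  fixes x \<gamma> :: real
  assumes "x > 1" "\<gamma> > 0"
  shows "\<gamma> * x powr (- \<gamma> - 1) \<le> (x - 1) powr - \<gamma> - x powr - \<gamma>"
proof -
  have "1 + \<gamma> / x \<le> exp (\<gamma> / x)" by simp
  also have "\<dots> \<le> exp (- \<gamma> * ln (1 - 1 / x))"
    using ln_le_minus_one[of "1 - 1 / x"] assms mult_left_mono[of "ln (1 - 1 / x)" "- 1 / x" \<gamma>] by simp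
  also have "\<dots> = ((x - 1) / x) powr - \<gamma>"
    using assms by (simp add: powr_def diff_divide_distrib)
  also have "\<dots> = (x - 1) powr - \<gamma> * x powr \<gamma>"
    using assms by (simp add: powr_divide powr_minus field_simps)
  finally have "(1 + \<gamma> / x) * x powr - \<gamma> \<le> (x - 1) powr - \<gamma> * x powr \<gamma> * x powr - \<gamma>"
    by (intro mult_right_mono) simp_all
  also have "\<dots> = (x - 1) powr - \<gamma>"
    using assms by (simp add: mult.assoc powr_add[symmetric])
  finally show ?thesis using assms by (simp add: algebra_simps powr_diff)
qed

text \<open>The first summand is split off, so that the comparison integral starts at
  \<open>Suc N\<close> and the bound is valid for \<open>N = 0\<close> as well.\<close>

lemma sum_powr_tail_le:
  assumes "\<beta> > 1"
  shows "(\<Sum>i=Suc N..n. real i powr - \<beta>)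
    \<le> real (Suc N) powr - \<beta> + real (Suc N) powr (1 - \<beta>) / (\<beta> - 1)"
proof (cases "Suc N \<le> n")
  case True
  \<comment> \<open>The negative boundary term at \<open>n\<close> is kept to make the induction
    work and is dropped afterwards.\<close>
  hence "(\<Sum>i=Suc N..n. real i powr - \<beta>)
    \<le> real (Suc N) powr - \<beta> + (real (Suc N) powr (1 - \<beta>) - real n powr (1 - \<beta>)) / (\<beta> - 1)"
  proof (induction n rule: dec_induct)
    case (step n)
    have "(\<beta> - 1) * real (Suc n) powr - \<beta> \<le> real n powr (1 - \<beta>) - real (Suc n) powr (1 - \<beta>)"
      using powr_minus_le_diff[of "real (Suc n)" "\<beta> - 1"] assms step.hyps by simp
    hence "real (Suc n) powr - \<beta> \<le> (real n powr (1 - \<beta>) - real (Suc n) powr (1 - \<beta>)) / (\<beta> - 1)"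
      using assms by (simp add: field_simps)
    with step show ?case by (simp add: diff_divide_distrib)
  qed simp
  also have "\<dots> \<le> real (Suc N) powr - \<beta> + real (Suc N) powr (1 - \<beta>) / (\<beta> - 1)"
    using assms by (intro add_left_mono divide_right_mono) simp_all
  finally show ?thesis .
qed (use assms in simp)

text \<open>In \<open>trunc_mean_zvec_le\<close> the first summand comes from the indices up to
  \<open>n * t powr p\<close>, the other two from the tail. The value blows up as \<open>p\<close>
  tends to 1 or to 2.\<close>

definition zconst :: "real \<Rightarrow> real" where
  "zconst p = 1 / (1 - 1 / p) + 1 + 1 / (2 / p - 1)"

lemma zconst_pos: "1 < p \<Longrightarrow> p < 2 \<Longrightarrow> 0 < zconst p"
  unfolding zconst_def by (intro add_pos_pos divide_pos_pos) (simp_all add: field_simps)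

text \<open>With \<open>m = n * t powr p\<close> one has
  \<open>t * zvec p n j = (m / j) powr (1 / p)\<close>, which crosses 1 at \<open>j = m\<close>. Up
  to there \<open>trunc_pow 2 s \<le> s\<close> is used, beyond it
  \<open>trunc_pow 2 s \<le> s powr 2\<close>. Both sums are of order \<open>m\<close> because
  \<open>1 / p < 1 < 2 / p\<close>.\<close>

lemma trunc_mean_zvec_le:
  assumes p: "1 < p" "p < 2" and n: "n \<ge> 1" and t: "t > 0"
  shows "trunc_mean 2 n (zvec p n) t \<le> zconst p * t powr p"
proof -
  define m where "m = real n * t powr p"
  define N where "N = nat \<lfloor>m\<rfloor>"
  define \<alpha> where "\<alpha> = 1 / p"
  define \<beta> where "\<beta> = 2 / p"
  have \<alpha>: "0 < \<alpha>" "\<alpha> < 1" and \<beta>: "1 < \<beta>" using p by (simp_all add: \<alpha>_def \<beta>_def)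
  have m: "m > 0" using n t by (simp add: m_def)
  have N: "real N \<le> m" "m \<le> real (Suc N)" "m < real (Suc N)" using m unfolding N_def by linarith+
  have arg: "t * zvec p n j = (m / real j) powr \<alpha>" for j
    using t p by (simp add: zvec_def m_def \<alpha>_def powr_divide powr_mult powr_powr)
  have small: "trunc_pow 2 (t * zvec p n j) \<le> m powr \<alpha> * real j powr - \<alpha>" for j
    using trunc_pow_le_self[of 2 "t * zvec p n j"] m
    by (simp add: arg powr_divide powr_minus_divide)
  have large: "trunc_pow 2 (t * zvec p n j) \<le> m powr \<beta> * real j powr - \<beta>" for j
    using trunc_pow_le_powr[of 2 "t * zvec p n j"] m
    by (simp add: arg powr_divide powr_minus_divide powr_powr \<alpha>_def \<beta>_def power_divide)
  have nonneg: "0 \<le> trunc_pow 2 (t * zvec p n j)" for j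
    using t by (intro trunc_pow_nonneg) (simp add: zvec_def)
  \<comment> \<open>\<open>N\<close> may exceed \<open>n\<close>, so the union can be larger than
    \<open>{1..n}\<close>; the additional terms are nonnegative.\<close>
  have "(\<Sum>j=1..n. trunc_pow 2 (t * zvec p n j))
    \<le> (\<Sum>j\<in>{1..N} \<union> {Suc N..n}. trunc_pow 2 (t * zvec p n j))"
    using nonneg by (intro sum_mono2) auto
  also have "\<dots> = (\<Sum>j=1..N. trunc_pow 2 (t * zvec p n j)) + (\<Sum>j=Suc N..n. trunc_pow 2 (t * zvec p n j))"
    by (intro sum.union_disjoint) auto
  also have "\<dots> \<le> (\<Sum>j=1..N. m powr \<alpha> * real j powr - \<alpha>) + (\<Sum>j=Suc N..n. m powr \<beta> * real j powr - \<beta>)"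
    using small large by (intro add_mono sum_mono) auto
  also have "\<dots> = m powr \<alpha> * (\<Sum>j=1..N. real j powr - \<alpha>) + m powr \<beta> * (\<Sum>j=Suc N..n. real j powr - \<beta>)"
    by (simp add: sum_distrib_left)
  also have "\<dots> \<le> m powr \<alpha> * (m powr (1 - \<alpha>) / (1 - \<alpha>)) + (m + m / (\<beta> - 1))"
  proof (rule add_mono)
    have "(\<Sum>j=1..N. real j powr - \<alpha>) \<le> real N powr (1 - \<alpha>) / (1 - \<alpha>)"
      by (rule sum_powr_minus_le[OF \<alpha>])
    also have "\<dots> \<le> m powr (1 - \<alpha>) / (1 - \<alpha>)"
      using \<alpha> N by (intro divide_right_mono powr_mono2) auto
    finally show "m powr \<alpha> * (\<Sum>j=1..N. real j powr - \<alpha>) \<le> m powr \<alpha> * (m powr (1 - \<alpha>) / (1 - \<alpha>))"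
      by (intro mult_left_mono) auto
  next
    have "m powr \<beta> * real (Suc N) powr - \<beta> = (m / real (Suc N)) powr \<beta>"
      using m by (simp add: powr_divide powr_minus_divide)
    also have "\<dots> \<le> (m / real (Suc N)) powr 1"
      using N m \<beta> by (intro powr_mono') auto
    also have "\<dots> \<le> m" using m by (simp add: field_simps)
    finally have 1: "m powr \<beta> * real (Suc N) powr - \<beta> \<le> m" .
    have "m powr \<beta> * real (Suc N) powr (1 - \<beta>) \<le> m powr \<beta> * m powr (1 - \<beta>)"
      using \<beta> m N by (intro mult_left_mono powr_mono2') auto
    also have "\<dots> = m" using m by (simp add: powr_add[symmetric])
    finally have 2: "m powr \<beta> * real (Suc N) powr (1 - \<beta>) \<le> m" .
    have "m powr \<beta> * (\<Sum>j=Suc N..n. real j powr - \<beta>)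
      \<le> m powr \<beta> * (real (Suc N) powr - \<beta> + real (Suc N) powr (1 - \<beta>) / (\<beta> - 1))"
      by (intro mult_left_mono sum_powr_tail_le \<beta>) auto
    also have "\<dots> = m powr \<beta> * real (Suc N) powr - \<beta> + m powr \<beta> * real (Suc N) powr (1 - \<beta>) / (\<beta> - 1)"
      by (simp add: distrib_left)
    also have "\<dots> \<le> m + m / (\<beta> - 1)"
      using 1 2 \<beta> by (intro add_mono divide_right_mono) auto
    finally show "m powr \<beta> * (\<Sum>j=Suc N..n. real j powr - \<beta>) \<le> m + m / (\<beta> - 1)" .
  qed
  also have "\<dots> = m * zconst p"
    using m by (simp add: powr_add[symmetric] zconst_def \<alpha>_def \<beta>_def algebra_simps)
  finally have "trunc_mean 2 n (zvec p n) t \<le> m * zconst p / n"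
    unfolding trunc_mean_def by (intro divide_right_mono) auto
  thus ?thesis using n by (simp add: m_def mult.commute)
qed

lemma zvec_nonneg: "0 \<le> zvec p n j"
  by (simp add: zvec_def)

text \<open>The indices \<open>j\<close> up to \<open>m = n * t powr p\<close> have argument at
  least 1 and contribute at least 1 each; \<open>t \<le> 1\<close> keeps them within
  \<open>{1..n}\<close>. The loss of \<open>1 / n\<close> is the price of rounding \<open>m\<close>
  down.\<close>

lemma trunc_mean_zvec_ge:
  assumes p: "p > 0" and n: "n \<ge> 1" and t: "0 \<le> t" "t \<le> 1"
  shows "t powr p - 1 / n \<le> trunc_mean 2 n (zvec p n) t"
proof -
  define m where "m = real n * t powr p"
  define N where "N = nat \<lfloor>m\<rfloor>"
  have "m \<ge> 0" by (simp add: m_def)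
  have "m \<le> real n * 1" unfolding m_def using t p by (intro mult_left_mono powr_le1) auto
  hence N: "real N \<le> m" "m - 1 \<le> real N" "N \<le> n" using \<open>m \<ge> 0\<close> unfolding N_def by linarith+
  have "m - 1 \<le> (\<Sum>j=1..N. 1)" using N by simp
  also have "\<dots> \<le> (\<Sum>j=1..N. trunc_pow 2 (t * zvec p n j))"
  proof (intro sum_mono trunc_pow_ge_1)
    fix j assume j: "j \<in> {1..N}"
    have "1 \<le> m / real j" using j N by (simp add: field_simps)
    hence "1 \<le> (m / real j) powr (1 / p)" using p by (intro ge_one_powr_ge_zero) auto
    also have "\<dots> = t * zvec p n j"
      using t p by (simp add: zvec_def m_def powr_divide powr_mult powr_powr)
    finally show "1 \<le> t * zvec p n j" .
  qed
  also have "\<dots> \<le> (\<Sum>j=1..n. trunc_pow 2 (t * zvec p n j))"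
    using N t by (intro sum_mono2 trunc_pow_nonneg mult_nonneg_nonneg zvec_nonneg) auto
  finally have "(m - 1) / n \<le> trunc_mean 2 n (zvec p n) t"
    unfolding trunc_mean_def by (intro divide_right_mono) auto
  thus ?thesis using n by (simp add: m_def diff_divide_distrib)
qed

lemma trunc_mean_zvec_ge_1:
  assumes p: "p > 0" and n: "n \<ge> 1" and t: "t \<ge> 1"
  shows "1 \<le> trunc_mean 2 n (zvec p n) t"
proof -
  have "real n = (\<Sum>j=1..n. 1)" by simp
  also have "\<dots> \<le> (\<Sum>j=1..n. trunc_pow 2 (t * zvec p n j))"
  proof (intro sum_mono trunc_pow_ge_1)
    fix j assume j: "j \<in> {1..n}"
    hence "1 \<le> zvec p n j" unfolding zvec_def using p by (intro ge_one_powr_ge_zero) auto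
    thus "1 \<le> t * zvec p n j" using t mult_mono[of 1 t 1 "zvec p n j"] by simp
  qed
  finally show ?thesis using n by (simp add: trunc_mean_def)
qed

section \<open>Averaging against z yields the lp norm\<close>

context
  fixes p :: real and n :: nat and y :: "nat \<Rightarrow> real"
  assumes p: "1 < p" "p < 2" and n: "n \<ge> 1" and y: "\<And>k. k \<in> {1..n} \<Longrightarrow> 0 \<le> y k"
begin

lemma sqrt_zvec_eq_lq_norm:
  "sqrt (\<Sum>k=1..n. (y k * zvec p n (\<eta> k))\<^sup>2) = (\<Sum>k=1..n. (y k * zvec p n (\<eta> k)) powr 2) powr (1 / 2)"
  using y zvec_nonneg by (intro sqrt_sum_squares_eq_powr mult_nonneg_nonneg) auto

text \<open>After division by the lp norm \<open>\<tau>\<close> of \<open>y\<close>, the values of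
  \<open>trunc_mean\<close> are bounded by \<open>zconst p\<close> times numbers that sum to
  1.\<close>

lemma perm_mean_zvec_le:
  "perm_mean n (\<lambda>\<eta>. sqrt (\<Sum>k=1..n. (y k * zvec p n (\<eta> k))\<^sup>2))
    \<le> (1 + zconst p) * (\<Sum>k=1..n. y k powr p) powr (1 / p)"
proof (cases "\<forall>k\<in>{1..n}. y k = 0")
  case True
  thus ?thesis by simp
next
  case False
  then obtain k0 where k0: "k0 \<in> {1..n}" "y k0 \<noteq> 0" by blast
  define s where "s = (\<Sum>k=1..n. y k powr p)"
  define \<tau> where "\<tau> = s powr (1 / p)"
  have "s > 0" unfolding s_def using k0 by (intro sum_pos2[of _ k0]) auto
  hence \<tau>: "\<tau> > 0" and \<tau>p: "\<tau> powr p = s" using p by (simp_all add: \<tau>_def powr_powr)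
  have "trunc_mean 2 n (zvec p n) (y k / \<tau>) \<le> zconst p * (y k powr p / s)" if "k \<in> {1..n}" for k
  proof (cases "y k = 0")
    case True
    thus ?thesis by (simp add: trunc_mean_def trunc_pow_def)
  next
    case False
    thus ?thesis
      using trunc_mean_zvec_le[OF p n, of "y k / \<tau>"] y[OF that] \<tau> \<tau>p by (simp add: powr_divide)
  qed
  hence "(\<Sum>k=1..n. trunc_mean 2 n (zvec p n) (y k / \<tau>)) \<le> (\<Sum>k=1..n. zconst p * (y k powr p / s))"
    by (intro sum_mono) auto
  also have "\<dots> = zconst p"
    unfolding sum_distrib_left[symmetric] sum_divide_distrib[symmetric] s_def[symmetric]
    using \<open>s > 0\<close> by simp
  finally have *: "(\<Sum>k=1..n. trunc_mean 2 n (zvec p n) (y k / \<tau>)) \<le> zconst p" .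
  have "perm_mean n (\<lambda>\<eta>. sqrt (\<Sum>k=1..n. (y k * zvec p n (\<eta> k))\<^sup>2))
    \<le> \<tau> * (1 + (\<Sum>k=1..n. trunc_mean 2 n (zvec p n) (y k / \<tau>)))"
    unfolding sqrt_zvec_eq_lq_norm using y \<tau> zvec_nonneg by (intro perm_mean_lq_norm_le_scaled) auto
  also have "\<dots> \<le> \<tau> * (1 + zconst p)"
    using * \<tau> by (intro mult_left_mono) auto
  finally show ?thesis by (simp add: \<tau>_def s_def mult.commute)
qed

lemma perm_mean_zvec_ge:
  "(\<Sum>k=1..n. y k powr p) powr (1 / p)
    \<le> 12 * perm_mean n (\<lambda>\<eta>. sqrt (\<Sum>k=1..n. (y k * zvec p n (\<eta> k))\<^sup>2))"
proof (cases "\<forall>k\<in>{1..n}. y k = 0")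
  case True
  thus ?thesis by simp
next
  case False
  then obtain k0 where k0: "k0 \<in> {1..n}" "y k0 \<noteq> 0" by blast
  define s where "s = (\<Sum>k=1..n. y k powr p)"
  \<comment> \<open>Half the lp norm: the p-th powers of \<open>y k / \<tau>\<close> then sum to
    \<open>2 powr p \<ge> 2\<close>, so at least 1 remains after \<open>n\<close> losses of
    \<open>1 / n\<close>. If some quotient reaches 1, its term alone suffices.\<close>
  define \<tau> where "\<tau> = s powr (1 / p) / 2"
  have "s > 0" unfolding s_def using k0 by (intro sum_pos2[of _ k0]) auto
  hence \<tau>: "\<tau> > 0" and \<tau>p: "\<tau> powr p = s / 2 powr p"
    using p by (simp_all add: \<tau>_def powr_powr powr_divide)
  have tnn: "0 \<le> trunc_mean 2 n (zvec p n) (y k / \<tau>)" if "k \<in> {1..n}" for k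
    using that y \<tau> zvec_nonneg by (intro trunc_mean_nonneg) auto
  have "1 \<le> (\<Sum>k=1..n. trunc_mean 2 n (zvec p n) (y k / \<tau>))"
  proof (cases "\<exists>k\<in>{1..n}. y k / \<tau> \<ge> 1")
    case True
    then obtain k where k: "k \<in> {1..n}" "y k / \<tau> \<ge> 1" by blast
    have "1 \<le> trunc_mean 2 n (zvec p n) (y k / \<tau>)"
      using trunc_mean_zvec_ge_1[of p n "y k / \<tau>"] p n k by simp
    also have "\<dots> \<le> (\<Sum>k=1..n. trunc_mean 2 n (zvec p n) (y k / \<tau>))"
      using k tnn by (intro member_le_sum) auto
    finally show ?thesis .
  next
    case False
    have "(2::real) powr 1 \<le> 2 powr p" using p by (intro powr_mono) auto
    hence "1 \<le> 2 powr p - 1" by simp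
    also have "\<dots> = (\<Sum>k=1..n. (y k / \<tau>) powr p - 1 / n)"
    proof -
      have "(\<Sum>k=1..n. (y k / \<tau>) powr p) = (\<Sum>k=1..n. y k powr p / \<tau> powr p)"
        using y \<tau> by (intro sum.cong) (auto simp: powr_divide)
      also have "\<dots> = 2 powr p"
        unfolding sum_divide_distrib[symmetric] s_def[symmetric] \<tau>p using \<open>s > 0\<close> by simp
      finally show ?thesis using n by (simp add: sum_subtractf)
    qed
    also have "\<dots> \<le> (\<Sum>k=1..n. trunc_mean 2 n (zvec p n) (y k / \<tau>))"
      using False p n y \<tau> by (intro sum_mono trunc_mean_zvec_ge) (auto simp: not_le intro: less_imp_le)
    finally show ?thesis .
  qed
  hence "1 / 2 \<le> (\<Sum>k=1..n. trunc_mean 2 n (zvec p n) (y k / \<tau>))" by simp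
  hence "\<tau> / 6 \<le> perm_mean n (\<lambda>\<eta>. sqrt (\<Sum>k=1..n. (y k * zvec p n (\<eta> k))\<^sup>2))"
    unfolding sqrt_zvec_eq_lq_norm using y \<tau> zvec_nonneg by (intro perm_mean_lq_norm_ge_scaled) auto
  thus ?thesis by (simp add: \<tau>_def s_def)
qed

end

section \<open>Orlicz functions and their conjugates\<close>

context
  fixes M :: "real \<Rightarrow> real"
  assumes M: "orlicz_function M"
begin

lemma orlicz_pos: "t > 0 \<Longrightarrow> M t > 0" and orlicz_0: "M 0 = 0"
  and orlicz_convex: "convex_on {0..} M"
  using M by (simp_all add: orlicz_function_def)

lemma orlicz_nonneg: "t \<ge> 0 \<Longrightarrow> M t \<ge> 0"
  using orlicz_pos orlicz_0 by (cases "t = 0") (auto intro: less_imp_le)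

lemma orlicz_scale: "0 \<le> c \<Longrightarrow> c \<le> 1 \<Longrightarrow> 0 \<le> t \<Longrightarrow> M (c * t) \<le> c * M t"
  using convex_onD[OF orlicz_convex, of c 0 t] orlicz_0 by simp

lemma orlicz_mono:
  assumes "0 \<le> s" "s \<le> t"
  shows "M s \<le> M t"
proof (cases "t = 0")
  case False
  hence "M s \<le> s / t * M t" using orlicz_scale[of "s / t" t] assms by simp
  also have "\<dots> \<le> 1 * M t" using assms False orlicz_nonneg[of t] by (intro mult_right_mono) auto
  finally show ?thesis by simp
qed (use assms in simp)

text \<open>Superlinear growth of \<open>M\<close> makes \<open>x * t - M t\<close> nonpositive for
  large \<open>t\<close>, so the supremum in the conjugate is a genuine one.\<close>

lemma orlicz_conj_bdd: "bdd_above ((\<lambda>t. x * t - M t) ` {0..})"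
proof -
  have "eventually (\<lambda>t. x \<le> M t / t) at_top"
    using M by (simp add: orlicz_function_def filterlim_at_top)
  then obtain T0 where T0: "\<And>t. t \<ge> T0 \<Longrightarrow> x \<le> M t / t"
    by (auto simp: eventually_at_top_linorder)
  define T where "T = max T0 1"
  have "x * t - M t \<le> \<bar>x\<bar> * T" if "t \<ge> 0" for t
  proof (cases "t \<ge> T")
    case True
    hence "x * t \<le> M t" using T0[of t] by (simp add: T_def field_simps)
    moreover have "0 \<le> \<bar>x\<bar> * T" by (simp add: T_def)
    ultimately show ?thesis by linarith
  next
    case False
    have "x * t \<le> \<bar>x\<bar> * t" using that by (intro mult_right_mono) auto
    also have "\<dots> \<le> \<bar>x\<bar> * T" using False by (intro mult_left_mono) auto
    finally show ?thesis using orlicz_nonneg[OF that] by linarith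
  qed
  thus ?thesis by (intro bdd_aboveI[of _ "\<bar>x\<bar> * T"]) auto
qed

lemma orlicz_conj_upper: "t \<ge> 0 \<Longrightarrow> x * t - M t \<le> orlicz_conj M x"
  unfolding orlicz_conj_def using orlicz_conj_bdd by (intro cSUP_upper) auto

lemma orlicz_conj_least: "(\<And>t. t \<ge> 0 \<Longrightarrow> x * t - M t \<le> K) \<Longrightarrow> orlicz_conj M x \<le> K"
  unfolding orlicz_conj_def by (intro cSUP_least) auto

lemma orlicz_conj_0: "orlicz_conj M 0 = 0"
proof (rule antisym)
  show "orlicz_conj M 0 \<le> 0" using orlicz_nonneg by (intro orlicz_conj_least) simp
  show "0 \<le> orlicz_conj M 0" using orlicz_conj_upper[of 0 0] orlicz_0 by simp
qed

lemma orlicz_conj_pos: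
  assumes "x > 0"
  shows "orlicz_conj M x > 0"
proof -
  have "eventually (\<lambda>t. M t / t < x) (at_right 0)"
    using M assms by (intro order_tendstoD) (auto simp: orlicz_function_def)
  moreover have "eventually (\<lambda>t::real. t > 0) (at_right 0)"
    by (simp add: eventually_at_right_less)
  ultimately have "eventually (\<lambda>t. t > 0 \<and> M t / t < x) (at_right 0)"
    by eventually_elim simp
  then obtain t where t: "t > 0" "M t / t < x"
    using eventually_happens'[OF trivial_limit_at_right_real] by blast
  hence "0 < x * t - M t" by (simp add: field_simps)
  also have "\<dots> \<le> orlicz_conj M x" using t by (intro orlicz_conj_upper) simp
  finally show ?thesis .
qed

text \<open>A supremum of affine functions. The whole line is taken as domain because it is open, so
  that convexity yields continuity.\<close>

lemma orlicz_conj_convex: "convex_on UNIV (orlicz_conj M)"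
proof (rule convex_onI)
  fix s x y :: real assume s: "0 < s" "s < 1"
  show "orlicz_conj M ((1 - s) *\<^sub>R x + s *\<^sub>R y) \<le> (1 - s) * orlicz_conj M x + s * orlicz_conj M y"
  proof (rule orlicz_conj_least)
    fix t :: real assume t: "t \<ge> 0"
    have "((1 - s) *\<^sub>R x + s *\<^sub>R y) * t - M t = (1 - s) * (x * t - M t) + s * (y * t - M t)"
      by (simp add: algebra_simps)
    also have "\<dots> \<le> (1 - s) * orlicz_conj M x + s * orlicz_conj M y"
      using s orlicz_conj_upper[OF t] by (intro add_mono mult_left_mono) auto
    finally show "((1 - s) *\<^sub>R x + s *\<^sub>R y) * t - M t \<le> (1 - s) * orlicz_conj M x + s * orlicz_conj M y" .
  qed
qed simp

lemma orlicz_conj_strict_mono: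
  assumes "0 \<le> x" "x < y"
  shows "orlicz_conj M x < orlicz_conj M y"
proof -
  have "orlicz_conj M x \<le> x / y * orlicz_conj M y"
    using convex_onD[OF orlicz_conj_convex, of "x / y" 0 y] assms orlicz_conj_0 by simp
  also have "\<dots> < 1 * orlicz_conj M y"
    using assms orlicz_conj_pos[of y] by (intro mult_strict_right_mono) auto
  finally show ?thesis by simp
qed

lemma orlicz_conj_inv:
  assumes "s \<ge> 0"
  shows "orlicz_conj_inv M s \<ge> 0" "orlicz_conj M (orlicz_conj_inv M s) = s"
proof -
  have inj: "inj_on (orlicz_conj M) {0..}"
    by (intro linorder_inj_onI') (use orlicz_conj_strict_mono in fastforce)
  have cont: "continuous_on {0..s + M 1} (orlicz_conj M)"
    using convex_on_continuous[OF open_UNIV orlicz_conj_convex] continuous_on_subset by blast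
  \<comment> \<open>Testing the supremum at \<open>t = 1\<close> provides the upper end for the
    intermediate value theorem.\<close>
  have "s \<le> orlicz_conj M (s + M 1)" using orlicz_conj_upper[of 1 "s + M 1"] by simp
  moreover have "0 \<le> s + M 1" using assms orlicz_pos[of 1] by simp
  ultimately have "\<exists>x. 0 \<le> x \<and> x \<le> s + M 1 \<and> orlicz_conj M x = s"
    using assms orlicz_conj_0 by (intro IVT' cont) auto
  hence mem: "s \<in> orlicz_conj M ` {0..}" by auto
  show "orlicz_conj_inv M s \<ge> 0"
    using the_inv_into_into[OF inj mem subset_refl] by (simp add: orlicz_conj_inv_def)
  show "orlicz_conj M (orlicz_conj_inv M s) = s"
    unfolding orlicz_conj_inv_def by (rule f_the_inv_into_f[OF inj mem])
qed

lemma orlicz_ge_conj_inv: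
  assumes "s \<ge> 0" "t \<ge> 0"
  shows "orlicz_conj_inv M s * t - s \<le> M t"
  using orlicz_conj_upper[OF assms(2), of "orlicz_conj_inv M s"] orlicz_conj_inv[OF assms(1)] by simp

text \<open>An approximate converse of Young's inequality. Let
  \<open>y = orlicz_conj_inv M s\<close> and \<open>t = s / (2 * y)\<close>. If
  \<open>M t > s\<close>, convexity forces \<open>M u \<ge> 2 * y * u\<close> for
  \<open>u \<ge> t\<close>, while \<open>y * u \<le> s / 2\<close> for \<open>u < t\<close>. Hence
  the conjugate at \<open>y\<close> is at most \<open>s / 2\<close>, although its value is
  \<open>s\<close>.\<close>

lemma orlicz_le_conj_inv:
  assumes s: "s > 0" and y: "orlicz_conj_inv M s > 0"
  shows "M (s / (2 * orlicz_conj_inv M s)) \<le> s"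
proof (rule ccontr)
  define y where "y = orlicz_conj_inv M s"
  define t where "t = s / (2 * y)"
  assume "\<not> ?thesis"
  hence Mt: "M t > s" by (simp add: t_def y_def)
  have "y > 0" "t > 0" using assms by (simp_all add: y_def t_def)
  have "orlicz_conj M y \<le> s / 2"
  proof (rule orlicz_conj_least)
    fix u :: real assume u: "u \<ge> 0"
    show "y * u - M u \<le> s / 2"
    proof (cases "u \<ge> t")
      case True
      have "M t \<le> t / u * M u"
        using orlicz_scale[of "t / u" u] True \<open>t > 0\<close> by simp
      hence "u / t * M t \<le> M u" using True \<open>t > 0\<close> by (simp add: field_simps)
      moreover have "u / t * s \<le> u / t * M t"
        using Mt u \<open>t > 0\<close> by (intro mult_left_mono) auto
      moreover have "u / t * s = 2 * (y * u)" using s \<open>y > 0\<close> by (simp add: t_def)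
      moreover have "0 \<le> y * u" using u \<open>y > 0\<close> by simp
      ultimately show ?thesis using s by linarith
    next
      case False
      hence "y * u \<le> y * t" using \<open>y > 0\<close> by simp
      also have "y * t = s / 2" using \<open>y > 0\<close> by (simp add: t_def)
      finally show ?thesis using orlicz_nonneg[OF u] by linarith
    qed
  qed
  thus False using orlicz_conj_inv(2)[of s] s by (simp add: y_def)
qed

end

section \<open>Comparison with the Orlicz-Lorentz norm\<close>

lemma exists_grid_point:
  fixes s :: real and n :: nat
  assumes "n \<ge> 1" "0 \<le> s" "s \<le> 1"
  obtains l where "l \<in> {1..n}" "s \<le> l / n" "l / n \<le> s + 1 / n"
proof
  \<comment> \<open>The maximum with 1 takes care of \<open>s = 0\<close>, since 0 is not an
    admissible index.\<close>
  define l where "l = max 1 (nat \<lceil>n * s\<rceil>)"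
  have ns: "0 \<le> n * s" "n * s \<le> n" using assms by (simp_all add: mult_left_le)
  show "l \<in> {1..n}" using ns assms by (simp add: l_def)
  have "n * s \<le> l" unfolding l_def by linarith
  thus "s \<le> l / n" using assms by (simp add: field_simps)
  have "l \<le> n * s + 1" using ns unfolding l_def by linarith
  hence "l / n \<le> (n * s + 1) / n" by (intro divide_right_mono) auto
  thus "l / n \<le> s + 1 / n" using assms by (simp add: add_divide_distrib)
qed

section \<open>Comparison of the truncated mean with M at grid points\<close>

context
  fixes A B p :: real and n :: nat and d :: "nat \<Rightarrow> real" and M :: "real \<Rightarrow> real"
  assumes A: "A > 0" and B: "B > 0" and p: "1 < p" and n: "n \<ge> 1"
    and d_anti: "antimono_on {1..n} d" and d_pos: "\<And>i. i \<in> {1..n} \<Longrightarrow> d i > 0"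
    and rel: "orlicz_related A B p n d M"
begin

definition related_rhs :: "nat \<Rightarrow> real" where
  "related_rhs l = (1 / real n) * (\<Sum>i=1..l. d i) +
     (real l / real n) powr (1 / conj_exponent p) *
       ((1 / real n) * (\<Sum>i=l+1..n. d i powr p)) powr (1 / p)"

lemma related_orlicz: "orlicz_function M"
  using rel by (simp add: orlicz_related_def)

lemma related_bounds:
  assumes "l \<in> {1..n}"
  shows "A * related_rhs l \<le> orlicz_conj_inv M (l / n)" "orlicz_conj_inv M (l / n) \<le> B * related_rhs l"
  using rel assms by (simp_all add: orlicz_related_def Let_def related_rhs_def)

lemma related_rhs_pos:
  assumes "l \<in> {1..n}"
  shows "related_rhs l > 0"
proof -
  have "0 < (1 / real n) * (\<Sum>i=1..l. d i)"
    using assms d_pos by (intro mult_pos_pos sum_pos) auto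
  thus ?thesis unfolding related_rhs_def by (intro add_pos_nonneg) auto
qed

text \<open>Up to constants, the point where both \<open>trunc_mean p n d\<close> and
  \<open>M\<close> reach \<open>l / n\<close>. For \<open>M\<close> this reflects that its inverse
  at \<open>s\<close> is comparable to \<open>s / orlicz_conj_inv M s\<close>.\<close>

definition grid :: "nat \<Rightarrow> real" where
  "grid l = (l / n) / related_rhs l"

lemma grid_pos: "l \<in> {1..n} \<Longrightarrow> grid l > 0"
  using related_rhs_pos by (simp add: grid_def)

lemma inverse_conj_exponent: "1 / conj_exponent p = 1 - 1 / p"
  using p by (simp add: conj_exponent_def field_simps)

lemma sum_split_at:
  assumes "l \<in> {1..n}"
  shows "(\<Sum>j=1..n. f j) = (\<Sum>j=1..l. f j) + (\<Sum>j=l+1..n. f j :: real)"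
  using assms sum.ub_add_nat[of 1 l f "n - l"] by simp

text \<open>The two summands of \<open>related_rhs l\<close> match the two regimes of
  \<open>trunc_pow\<close>: the linear bound on the first \<open>l\<close> weights and the power
  bound on the others each contribute at most \<open>l / n\<close>.\<close>

lemma trunc_mean_grid_le:
  assumes l: "l \<in> {1..n}"
  shows "trunc_mean p n d (grid l) \<le> 2 * (l / n)"
proof -
  define r where "r = related_rhs l"
  define t where "t = grid l"
  define s where "s = real l / n"
  define D where "D = (1 / real n) * (\<Sum>i=l+1..n. d i powr p)"
  have "r > 0" "s > 0" "t > 0" using related_rhs_pos[OF l] grid_pos[OF l] l by (simp_all add: r_def s_def t_def)
  have t: "t = s / r" by (simp add: t_def s_def r_def grid_def)
  have "D \<ge> 0" unfolding D_def by (intro mult_nonneg_nonneg sum_nonneg) auto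
  have r: "r = (1 / real n) * (\<Sum>i=1..l. d i) + s powr (1 - 1 / p) * D powr (1 / p)"
    by (simp add: r_def related_rhs_def D_def s_def inverse_conj_exponent)
  have head: "(1 / real n) * (\<Sum>i=1..l. d i) \<le> r" unfolding r by simp
  have "0 \<le> (1 / real n) * (\<Sum>i=1..l. d i)"
    using d_pos l by (intro mult_nonneg_nonneg sum_nonneg) (auto intro: less_imp_le)
  hence "s powr (1 - 1 / p) * D powr (1 / p) \<le> r" unfolding r by simp
  hence "t * (s powr (1 - 1 / p) * D powr (1 / p)) \<le> s"
    using \<open>r > 0\<close> \<open>s > 0\<close> by (simp add: t field_simps)
  hence "(t * (s powr (1 - 1 / p) * D powr (1 / p))) powr p \<le> s powr p"
    using \<open>t > 0\<close> p by (intro powr_mono2) auto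
  moreover have "(1 - 1 / p) * p = p - 1" using p by (simp add: left_diff_distrib)
  ultimately have "t powr p * D * s powr (p - 1) \<le> s powr p"
    using \<open>t > 0\<close> \<open>D \<ge> 0\<close> p by (simp add: powr_mult powr_powr mult_ac)
  also have "s powr p = s * s powr (p - 1)" using \<open>s > 0\<close> by (simp add: powr_mult_base)
  finally have tail: "t powr p * D \<le> s" using \<open>s > 0\<close> by simp
  have "(\<Sum>j=1..n. trunc_pow p (t * d j))
    = (\<Sum>j=1..l. trunc_pow p (t * d j)) + (\<Sum>j=l+1..n. trunc_pow p (t * d j))"
    by (rule sum_split_at[OF l])
  also have "\<dots> \<le> (\<Sum>j=1..l. t * d j) + (\<Sum>j=l+1..n. (t * d j) powr p)"
    using l p \<open>t > 0\<close> d_pos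
    by (intro add_mono sum_mono trunc_pow_le_self trunc_pow_le_powr) (auto intro!: mult_nonneg_nonneg less_imp_le)
  also have "(\<Sum>j=l+1..n. (t * d j) powr p) = (\<Sum>j=l+1..n. t powr p * d j powr p)"
    using d_pos \<open>t > 0\<close> by (intro sum.cong) (auto simp: powr_mult less_imp_le)
  finally have "trunc_mean p n d t
      \<le> ((\<Sum>j=1..l. t * d j) + (\<Sum>j=l+1..n. t powr p * d j powr p)) / n"
    unfolding trunc_mean_def by (intro divide_right_mono) auto
  also have "\<dots> = t * ((1 / real n) * (\<Sum>i=1..l. d i)) + t powr p * D"
    by (simp add: add_divide_distrib D_def sum_distrib_left sum_divide_distrib)
  also have "\<dots> \<le> t * r + s"
    using head tail \<open>t > 0\<close> by (intro add_mono mult_left_mono) auto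
  also have "\<dots> = 2 * s" using \<open>r > 0\<close> by (simp add: t)
  finally show ?thesis by (simp add: t_def s_def)
qed

text \<open>On the first \<open>l\<close> weights, \<open>s \<le> 1 + trunc_pow p s\<close> bounds
  the linear sum by \<open>2 * l\<close>. On the others \<open>trunc_pow\<close> is the exact power,
  which contributes one more \<open>l / n\<close>; together this gives the factor 3.\<close>

lemma le_grid_of_trunc_mean_le:
  assumes l: "l \<in> {1..n}" and t: "t \<ge> 0" and F: "trunc_mean p n d t \<le> l / n"
  shows "t \<le> 3 * grid l"
proof (cases "t = 0")
  case True
  thus ?thesis using grid_pos[OF l] by simp
next
  case False
  hence "t > 0" using t by simp
  define s where "s = real l / n"
  define D where "D = (1 / real n) * (\<Sum>i=l+1..n. d i powr p)"
  have "s > 0" using l by (simp add: s_def)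
  have "D \<ge> 0" unfolding D_def by (intro mult_nonneg_nonneg sum_nonneg) auto
  have td: "0 \<le> t * d j" if "j \<in> {1..n}" for j
    using t d_pos[OF that] by simp
  have tot: "(\<Sum>j=1..n. trunc_pow p (t * d j)) \<le> l"
    using F n by (simp add: trunc_mean_def divide_le_cancel)
  have "(\<Sum>j=1..l. t * d j) \<le> (\<Sum>j=1..l. 1 + trunc_pow p (t * d j))"
    by (intro sum_mono le_1_plus_trunc_pow)
  also have "\<dots> = l + (\<Sum>j=1..l. trunc_pow p (t * d j))" by (simp add: sum.distrib)
  also have "(\<Sum>j=1..l. trunc_pow p (t * d j)) \<le> (\<Sum>j=1..n. trunc_pow p (t * d j))"
    using l td by (intro sum_mono2 trunc_pow_nonneg) auto
  finally have "(\<Sum>j=1..l. t * d j) \<le> 2 * l" using tot by simp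
  hence "(\<Sum>j=1..l. t * d j) / n \<le> 2 * l / n" by (intro divide_right_mono) auto
  hence head: "t * ((1 / real n) * (\<Sum>i=1..l. d i)) \<le> 2 * s"
    by (simp add: s_def sum_distrib_left sum_divide_distrib)
  \<comment> \<open>If \<open>t * d j\<close> exceeded 1 for some \<open>j > l\<close>, monotonicity
    of \<open>d\<close> would make the first \<open>j\<close> terms at least 1 each, and the total
    would exceed \<open>l\<close>.\<close>
  have small: "t * d j \<le> 1" if j: "j \<in> {l+1..n}" for j
  proof (rule ccontr)
    assume "\<not> ?thesis"
    hence big: "1 < t * d i" if "i \<in> {1..j}" for i
    proof -
      have "d j \<le> d i" using d_anti that j by (auto simp: monotone_on_def)
      hence "t * d j \<le> t * d i" using t by (intro mult_left_mono) auto
      thus ?thesis using \<open>\<not> t * d j \<le> 1\<close> by linarith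
    qed
    have "real j = (\<Sum>i=1..j. 1)" by simp
    also have "\<dots> \<le> (\<Sum>i=1..j. trunc_pow p (t * d i))"
      using big by (intro sum_mono trunc_pow_ge_1) (auto intro: less_imp_le)
    also have "\<dots> \<le> (\<Sum>i=1..n. trunc_pow p (t * d i))"
      using j td by (intro sum_mono2 trunc_pow_nonneg) auto
    finally show False using tot j by simp
  qed
  have "(\<Sum>j=l+1..n. t powr p * d j powr p) = (\<Sum>j=l+1..n. trunc_pow p (t * d j))"
    using small d_pos t by (intro sum.cong) (auto simp: trunc_pow_def powr_mult less_imp_le)
  also have "\<dots> \<le> (\<Sum>j=1..n. trunc_pow p (t * d j))"
    using td by (intro sum_mono2 trunc_pow_nonneg) auto
  also have "\<dots> \<le> l" by (rule tot)
  finally have "(\<Sum>j=l+1..n. t powr p * d j powr p) / n \<le> l / n" by (intro divide_right_mono) auto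
  hence "t powr p * D \<le> s" by (simp add: D_def s_def sum_distrib_left sum_divide_distrib)
  hence "(t powr p * D) powr (1 / p) \<le> s powr (1 / p)"
    using p \<open>D \<ge> 0\<close> by (intro powr_mono2) auto
  hence "t * D powr (1 / p) \<le> s powr (1 / p)"
    using p t \<open>D \<ge> 0\<close> by (simp add: powr_mult powr_powr)
  hence "s powr (1 - 1 / p) * (t * D powr (1 / p)) \<le> s powr (1 - 1 / p) * s powr (1 / p)"
    by (intro mult_left_mono) auto
  also have "\<dots> = s" using \<open>s > 0\<close> by (simp add: powr_add[symmetric])
  finally have tail: "t * (s powr (1 - 1 / p) * D powr (1 / p)) \<le> s" by (simp add: mult_ac)
  have "t * related_rhs l = t * ((1 / real n) * (\<Sum>i=1..l. d i)) + t * (s powr (1 - 1 / p) * D powr (1 / p))"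
    by (simp add: related_rhs_def D_def s_def inverse_conj_exponent distrib_left)
  also have "\<dots> \<le> 3 * s" using head tail by linarith
  finally have "t \<le> 3 * s / related_rhs l"
    using related_rhs_pos[OF l] by (subst pos_le_divide_eq) simp_all
  thus ?thesis by (simp add: grid_def s_def)
qed

lemma conj_inv_grid_pos: "l \<in> {1..n} \<Longrightarrow> 0 < orlicz_conj_inv M (l / n)"
  using related_bounds(1)[of l] related_rhs_pos[of l] A by (smt (verit) mult_pos_pos)

text \<open>With \<open>y = orlicz_conj_inv M (l / n)\<close>, Young's inequality gives
  \<open>y * t \<le> 2 * (l / n)\<close>, and \<open>y\<close> is at least
  \<open>A * related_rhs l\<close>.\<close>

lemma le_grid_of_orlicz_le:
  assumes l: "l \<in> {1..n}" and t: "t \<ge> 0" and Mt: "M t \<le> l / n"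
  shows "t \<le> 2 / A * grid l"
proof -
  have "orlicz_conj_inv M (l / n) * t - l / n \<le> M t"
    by (intro orlicz_ge_conj_inv[OF related_orlicz] t) simp
  hence "orlicz_conj_inv M (l / n) * t \<le> 2 * (l / n)" using Mt by simp
  moreover have "A * related_rhs l * t \<le> orlicz_conj_inv M (l / n) * t"
    using related_bounds(1)[OF l] t by (intro mult_right_mono)
  ultimately have "t * (A * related_rhs l) \<le> 2 * (l / n)" by (simp add: mult.commute)
  hence "t \<le> 2 * (l / n) / (A * related_rhs l)"
    using A related_rhs_pos[OF l] by (subst pos_le_divide_eq) simp_all
  thus ?thesis by (simp add: grid_def mult_ac)
qed

lemma orlicz_grid_le:
  assumes l: "l \<in> {1..n}"
  shows "M (grid l / (2 * B)) \<le> l / n"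
proof -
  define y where "y = orlicz_conj_inv M (l / n)"
  have y: "y > 0" "y \<le> B * related_rhs l"
    using conj_inv_grid_pos[OF l] related_bounds(2)[OF l] by (simp_all add: y_def)
  have "(l / n) / (2 * (B * related_rhs l)) \<le> (l / n) / (2 * y)"
    using y B related_rhs_pos[OF l] by (intro divide_left_mono) auto
  hence "grid l / (2 * B) \<le> (l / n) / (2 * y)"
    by (simp add: grid_def mult_ac)
  hence "M (grid l / (2 * B)) \<le> M ((l / n) / (2 * y))"
    using grid_pos[OF l] B by (intro orlicz_mono[OF related_orlicz]) auto
  also have "\<dots> \<le> l / n"
    unfolding y_def using l conj_inv_grid_pos[OF l] by (intro orlicz_le_conj_inv[OF related_orlicz]) auto
  finally show ?thesis .
qed

text \<open>Both functions are compared at a grid point just above \<open>M t\<close>. The additive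
  error comes from the grid spacing and adds up to a mere constant over \<open>n\<close>
  coordinates.\<close>

lemma trunc_mean_le_orlicz:
  assumes t: "t \<ge> 0" and Mt: "M t \<le> 1"
  shows "trunc_mean p n d (A / 2 * t) \<le> 2 * M t + 2 / n"
proof -
  obtain l where l: "l \<in> {1..n}" "M t \<le> l / n" "l / n \<le> M t + 1 / n"
    using exists_grid_point[OF n orlicz_nonneg[OF related_orlicz t] Mt] by blast
  have "A / 2 * t \<le> grid l"
    using le_grid_of_orlicz_le[OF l(1) t l(2)] A by (simp add: field_simps)
  hence "trunc_mean p n d (A / 2 * t) \<le> trunc_mean p n d (grid l)"
    using A t p d_pos by (intro trunc_mean_mono) (auto intro: less_imp_le)
  also have "\<dots> \<le> 2 * (l / n)" by (rule trunc_mean_grid_le[OF l(1)])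
  also have "\<dots> \<le> 2 * (M t + 1 / n)" using l(3) by simp
  finally show ?thesis by simp
qed

lemma orlicz_le_trunc_mean:
  assumes t: "t \<ge> 0" and F: "trunc_mean p n d t \<le> 1"
  shows "M (t / (6 * B)) \<le> trunc_mean p n d t + 1 / n"
proof -
  have "0 \<le> trunc_mean p n d t" using t d_pos by (intro trunc_mean_nonneg) (auto intro: less_imp_le)
  then obtain l where l: "l \<in> {1..n}" "trunc_mean p n d t \<le> l / n" "l / n \<le> trunc_mean p n d t + 1 / n"
    using exists_grid_point[OF n _ F] by blast
  have "t / (6 * B) \<le> grid l / (2 * B)"
    using le_grid_of_trunc_mean_le[OF l(1) t l(2)] B by (simp add: field_simps)
  hence "M (t / (6 * B)) \<le> M (grid l / (2 * B))"
    using t B by (intro orlicz_mono[OF related_orlicz]) auto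
  also have "\<dots> \<le> l / n" by (rule orlicz_grid_le[OF l(1)])
  finally show ?thesis using l(3) by simp
qed

section \<open>Consequences for the Orlicz-Lorentz norm\<close>

context
  fixes a x :: "nat \<Rightarrow> real"
  assumes ax: "\<And>i. i \<in> {1..n} \<Longrightarrow> 0 \<le> a i * rearr n x i"
begin

text \<open>Lower bounds for the infimum defining the norm require a nonempty set. Convexity makes
  \<open>\<rho> = 1 + (\<Sum>i=1..n. M (a i * rearr n x i))\<close> admissible.\<close>

lemma orlicz_lorentz_feasible:
  obtains \<rho> where "\<rho> > 0" "(\<Sum>i=1..n. M (a i * rearr n x i / \<rho>)) \<le> 1"
proof
  define \<rho> where "\<rho> = 1 + (\<Sum>i=1..n. M (a i * rearr n x i))"
  have sum: "0 \<le> (\<Sum>i=1..n. M (a i * rearr n x i))"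
    using ax by (intro sum_nonneg orlicz_nonneg[OF related_orlicz]) auto
  hence \<rho>: "\<rho> \<ge> 1" by (simp add: \<rho>_def)
  thus "\<rho> > 0" by simp
  have "(\<Sum>i=1..n. M (a i * rearr n x i / \<rho>)) \<le> (\<Sum>i=1..n. 1 / \<rho> * M (a i * rearr n x i))"
  proof (rule sum_mono)
    fix i assume "i \<in> {1..n}"
    thus "M (a i * rearr n x i / \<rho>) \<le> 1 / \<rho> * M (a i * rearr n x i)"
      using orlicz_scale[OF related_orlicz, of "1 / \<rho>" "a i * rearr n x i"] ax \<rho> by simp
  qed
  also have "\<dots> = (\<Sum>i=1..n. M (a i * rearr n x i)) / \<rho>" by (simp add: sum_divide_distrib)
  also have "\<dots> \<le> 1" using sum \<rho> by (simp add: \<rho>_def)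
  finally show "(\<Sum>i=1..n. M (a i * rearr n x i / \<rho>)) \<le> 1" .
qed

lemma perm_mean_le_orlicz_lorentz_norm:
  "perm_mean n (\<lambda>\<sigma>. (\<Sum>k=1..n. (a k * rearr n x k * d (\<sigma> k)) powr p) powr (1 / p))
    \<le> 10 / A * orlicz_lorentz_norm n M a x"
proof -
  define E where "E = perm_mean n (\<lambda>\<sigma>. (\<Sum>k=1..n. (a k * rearr n x k * d (\<sigma> k)) powr p) powr (1 / p))"
  have "A / 10 * E \<le> \<rho>" if \<rho>: "\<rho> > 0" "(\<Sum>i=1..n. M (a i * rearr n x i / \<rho>)) \<le> 1" for \<rho>
  proof -
    define t where "t i = a i * rearr n x i / \<rho>" for i
    \<comment> \<open>Division by this \<open>\<tau>\<close> turns the entries into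
      \<open>A / 2 * t i\<close>, the argument in \<open>trunc_mean_le_orlicz\<close>. The sum is
      then at most \<open>2 + 2\<close>, which leads to
      \<open>\<tau> * 5 = 10 * \<rho> / A\<close>.\<close>
    define \<tau> where "\<tau> = 2 * \<rho> / A"
    have t: "0 \<le> t i" if "i \<in> {1..n}" for i using ax[OF that] \<rho> by (simp add: t_def)
    have M1: "M (t i) \<le> 1" if "i \<in> {1..n}" for i
    proof -
      have "M (t i) \<le> (\<Sum>i=1..n. M (t i))"
        using that t by (intro member_le_sum orlicz_nonneg[OF related_orlicz]) auto
      thus ?thesis using \<rho> by (simp add: t_def)
    qed
    have "(\<Sum>k=1..n. trunc_mean p n d (a k * rearr n x k / \<tau>)) = (\<Sum>k=1..n. trunc_mean p n d (A / 2 * t k))"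
      by (simp add: \<tau>_def t_def mult_ac)
    also have "\<dots> \<le> (\<Sum>k=1..n. 2 * M (t k) + 2 / n)"
      using t M1 by (intro sum_mono trunc_mean_le_orlicz)
    also have "\<dots> = 2 * (\<Sum>k=1..n. M (t k)) + 2"
      using n by (simp add: sum.distrib sum_distrib_left)
    also have "\<dots> \<le> 4" using \<rho> by (simp add: t_def)
    finally have *: "(\<Sum>k=1..n. trunc_mean p n d (a k * rearr n x k / \<tau>)) \<le> 4" .
    have "\<tau> > 0" using \<rho> A by (simp add: \<tau>_def)
    have "E \<le> \<tau> * (1 + (\<Sum>k=1..n. trunc_mean p n d (a k * rearr n x k / \<tau>)))"
      unfolding E_def using p \<open>\<tau> > 0\<close> ax d_pos
      by (intro perm_mean_lq_norm_le_scaled) (auto intro: less_imp_le)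
    also have "\<dots> \<le> \<tau> * 5" using * \<open>\<tau> > 0\<close> by (intro mult_left_mono) auto
    finally show ?thesis using A by (simp add: \<tau>_def field_simps)
  qed
  hence "A / 10 * E \<le> orlicz_lorentz_norm n M a x"
    unfolding orlicz_lorentz_norm_def using orlicz_lorentz_feasible
    by (intro cInf_greatest) auto
  hence "E \<le> 10 / A * orlicz_lorentz_norm n M a x" using A by (simp add: field_simps)
  thus ?thesis by (simp only: E_def)
qed

lemma orlicz_lorentz_norm_le_perm_mean:
  "orlicz_lorentz_norm n M a x
    \<le> 72 * B * perm_mean n (\<lambda>\<sigma>. (\<Sum>k=1..n. (a k * rearr n x k * d (\<sigma> k)) powr p) powr (1 / p))"
proof -
  define E where "E = perm_mean n (\<lambda>\<sigma>. (\<Sum>k=1..n. (a k * rearr n x k * d (\<sigma> k)) powr p) powr (1 / p))"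
  have "E \<ge> 0" unfolding E_def by (intro perm_mean_nonneg) auto
  \<comment> \<open>Taking \<open>\<tau>\<close> strictly above \<open>6 * E\<close> keeps it
    positive even when \<open>E = 0\<close> and contradicts the lower bound
    \<open>\<tau> / 6 \<le> E\<close> below; density of the reals then removes the gap.\<close>
  have "orlicz_lorentz_norm n M a x / (12 * B) \<le> \<tau>" if \<tau>: "6 * E < \<tau>" for \<tau>
  proof -
    have "\<tau> > 0" using \<tau> \<open>E \<ge> 0\<close> by simp
    define t where "t k = a k * rearr n x k / \<tau>" for k
    have t: "0 \<le> t i" if "i \<in> {1..n}" for i using ax[OF that] \<open>\<tau> > 0\<close> by (simp add: t_def)
    have F0: "0 \<le> trunc_mean p n d (t i)" if "i \<in> {1..n}" for i
      using t[OF that] d_pos by (intro trunc_mean_nonneg) (auto intro: less_imp_le)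
    have F: "(\<Sum>k=1..n. trunc_mean p n d (t k)) \<le> 1"
    proof (rule ccontr)
      assume "\<not> ?thesis"
      hence "\<tau> / 6 \<le> E"
        unfolding E_def t_def using p \<open>\<tau> > 0\<close> ax d_pos
        by (intro perm_mean_lq_norm_ge_scaled) (auto intro: less_imp_le)
      thus False using \<tau> by simp
    qed
    have F1: "trunc_mean p n d (t i) \<le> 1" if "i \<in> {1..n}" for i
    proof -
      have "trunc_mean p n d (t i) \<le> (\<Sum>k=1..n. trunc_mean p n d (t k))"
        using that F0 by (intro member_le_sum) auto
      thus ?thesis using F by simp
    qed
    \<comment> \<open>Using \<open>12 * B\<close> instead of \<open>6 * B\<close> gains a factor
      \<open>1 / 2\<close> by convexity, which brings the bound \<open>1 + n * (1 / n) = 2\<close>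
      down to 1.\<close>
    have "(\<Sum>k=1..n. M (a k * rearr n x k / (12 * B * \<tau>))) \<le> (\<Sum>k=1..n. 1 / 2 * (trunc_mean p n d (t k) + 1 / n))"
    proof (rule sum_mono)
      fix k assume k: "k \<in> {1..n}"
      have "M (a k * rearr n x k / (12 * B * \<tau>)) = M (1 / 2 * (t k / (6 * B)))"
        by (simp add: t_def mult_ac)
      also have "\<dots> \<le> 1 / 2 * M (t k / (6 * B))"
        using t[OF k] B by (intro orlicz_scale[OF related_orlicz]) auto
      also have "\<dots> \<le> 1 / 2 * (trunc_mean p n d (t k) + 1 / n)"
        by (intro mult_left_mono orlicz_le_trunc_mean t F1 k) simp
      finally show "M (a k * rearr n x k / (12 * B * \<tau>)) \<le> 1 / 2 * (trunc_mean p n d (t k) + 1 / n)" .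
    qed
    also have "\<dots> = 1 / 2 * ((\<Sum>k=1..n. trunc_mean p n d (t k)) + 1)"
      unfolding sum_distrib_left[symmetric] using n by (simp add: sum.distrib)
    also have "\<dots> \<le> 1" using F by simp
    finally have "orlicz_lorentz_norm n M a x \<le> 12 * B * \<tau>"
      unfolding orlicz_lorentz_norm_def using B \<open>\<tau> > 0\<close>
      by (intro cInf_lower bdd_belowI[of _ 0]) auto
    thus ?thesis using B by (simp add: field_simps)
  qed
  hence "orlicz_lorentz_norm n M a x / (12 * B) \<le> 6 * E" by (rule dense_ge)
  hence "orlicz_lorentz_norm n M a x \<le> 72 * B * E" using B by (simp add: field_simps)
  thus ?thesis by (simp only: E_def)
qed

end

end

section \<open>Rearrangements and random blocks\<close>

text \<open>The sorted list is a permuted copy of the original one. Its permutation of list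
  positions, which start at 0, is shifted to \<open>{1..n}\<close> and extended by the
  identity.\<close>

lemma rearr_eq_permuted:
  obtains \<tau> where "\<tau> permutes {1..n}" "\<And>i. i \<in> {1..n} \<Longrightarrow> rearr n x i = \<bar>x (\<tau> i)\<bar>"
proof -
  let ?L = "map (\<lambda>j. \<bar>x j\<bar>) [1..<Suc n]"
  have len: "length ?L = n" by simp
  have "mset (rev (sort ?L)) = mset ?L" by simp
  then obtain p where p: "p permutes {..<length ?L}" "permute_list p ?L = rev (sort ?L)"
    by (rule mset_eq_permutation)
  define \<tau> where "\<tau> i = (if i \<in> {1..n} then Suc (p (i - 1)) else i)" for i
  have "bij_betw (Suc \<circ> (p \<circ> (\<lambda>i. i - 1))) {1..n} {1..n}"
  proof (rule bij_betw_trans, rule bij_betw_trans)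
    show "bij_betw (\<lambda>i. i - 1) {1..n} {..<n}"
      by (rule bij_betw_byWitness[of _ Suc]) auto
    show "bij_betw p {..<n} {..<n}"
      using permutes_imp_bij[OF p(1)] by (simp only: len)
    show "bij_betw Suc {..<n} {1..n}"
      by (rule bij_betw_byWitness[of _ "\<lambda>i. i - 1"]) auto
  qed
  hence "bij_betw \<tau> {1..n} {1..n}"
    by (rule bij_betw_cong[THEN iffD1, rotated]) (simp add: \<tau>_def)
  hence "\<tau> permutes {1..n}"
    by (rule bij_imp_permutes) (auto simp: \<tau>_def)
  moreover have "rearr n x i = \<bar>x (\<tau> i)\<bar>" if i: "i \<in> {1..n}" for i
  proof -
    have i': "i - 1 < length ?L" using i by auto
    have "rearr n x i = permute_list p ?L ! (i - 1)" by (simp only: rearr_def p(2))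
    also have "\<dots> = ?L ! (p (i - 1))" by (rule permute_list_nth[OF p(1) i'])
    also have "\<dots> = \<bar>x (\<tau> i)\<bar>"
    proof -
      have "p (i - 1) < n" using permutes_in_image[OF p(1), of "i - 1"] i' by (simp only: len lessThan_iff)
      thus ?thesis using i by (simp add: \<tau>_def del: upt_Suc)
    qed
    finally show ?thesis .
  qed
  ultimately show ?thesis by (rule that)
qed

lemma rearr_nonneg: "i \<in> {1..n} \<Longrightarrow> 0 \<le> rearr n x i"
  using rearr_eq_permuted[of n x] by (metis abs_ge_zero)

lemma rearr_antimono:
  assumes "i \<in> {1..n}" "j \<in> {1..n}" "i \<le> j"
  shows "rearr n x j \<le> rearr n x i"
  unfolding rearr_def using assms by (intro sorted_rev_nth_mono) auto

text \<open>Intended for the two vectors of averages in the hypotheses, which are already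
  nonincreasing.\<close>

lemma rearr_eq_self:
  assumes nonneg: "\<And>i. i \<in> {1..n} \<Longrightarrow> 0 \<le> y i"
    and anti: "\<And>i j. i \<in> {1..n} \<Longrightarrow> j \<in> {1..n} \<Longrightarrow> i \<le> j \<Longrightarrow> y j \<le> y i"
    and i: "i \<in> {1..n}"
  shows "rearr n y i = y i"
proof -
  let ?L = "map (\<lambda>j. \<bar>y j\<bar>) [1..<Suc n]"
  have "sorted (rev ?L)"
    unfolding sorted_rev_iff_nth_mono using nonneg anti by (auto simp del: upt_Suc)
  hence "sort ?L = rev ?L" by (intro properties_for_sort) auto
  hence "rearr n y i = ?L ! (i - 1)" by (simp only: rearr_def rev_rev_ident)
  also have "\<dots> = y i" using i nonneg[OF i] by (subst nth_map) (auto simp del: upt_Suc)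
  finally show ?thesis .
qed

text \<open>The average of the first \<open>k\<close> values is at least \<open>g k\<close>, and
  each later value is at most \<open>g k\<close>.\<close>

lemma initial_average_antimono:
  fixes g :: "nat \<Rightarrow> real"
  assumes anti: "\<And>i j. i \<in> {1..n} \<Longrightarrow> j \<in> {1..n} \<Longrightarrow> i \<le> j \<Longrightarrow> g j \<le> g i"
    and k: "k \<in> {1..n}" "l \<in> {1..n}" "k \<le> l"
  shows "(1 / real l) * (\<Sum>i=1..l. g i) \<le> (1 / real k) * (\<Sum>i=1..k. g i)"
proof -
  have "(\<Sum>i=1..k. g k) \<le> (\<Sum>i=1..k. g i)"
    using k by (intro sum_mono anti) auto
  hence low: "k * g k \<le> (\<Sum>i=1..k. g i)" by simp
  have "(\<Sum>i=k+1..l. g i) \<le> (\<Sum>i=k+1..l. g k)"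
    using k by (intro sum_mono anti) auto
  hence high: "(\<Sum>i=k+1..l. g i) \<le> (real l - real k) * g k" using k by simp
  have "k * (\<Sum>i=1..l. g i) = k * (\<Sum>i=1..k. g i) + k * (\<Sum>i=k+1..l. g i)"
    using sum.ub_add_nat[of 1 k g "l - k"] k by (simp add: distrib_left)
  also have "\<dots> \<le> k * (\<Sum>i=1..k. g i) + k * ((real l - real k) * g k)"
    using high by (intro add_left_mono mult_left_mono) auto
  also have "k * ((real l - real k) * g k) = (real l - real k) * (k * g k)" by simp
  also have "\<dots> \<le> (real l - real k) * (\<Sum>i=1..k. g i)"
    using low k by (intro mult_left_mono) auto
  finally have "k * (\<Sum>i=1..l. g i) \<le> l * (\<Sum>i=1..k. g i)" by (simp add: algebra_simps)
  thus ?thesis using k by (simp add: field_simps)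
qed

lemma tail_average_antimono:
  fixes g :: "nat \<Rightarrow> real"
  assumes "\<And>i. i \<in> {1..n} \<Longrightarrow> 0 \<le> g i" and k: "k \<ge> 1" "k \<le> l"
  shows "(1 / real l) * (\<Sum>i=l+1..n. g i) \<le> (1 / real k) * (\<Sum>i=k+1..n. g i)"
  using assms by (intro mult_mono divide_left_mono sum_mono2 sum_nonneg) auto

lemma L2_set_sum_le:
  assumes "finite P"
  shows "L2_set (\<lambda>k. \<Sum>\<pi>\<in>P. g k \<pi>) K \<le> (\<Sum>\<pi>\<in>P. L2_set (\<lambda>k. g k \<pi>) K)"
  using assms
proof (induction P)
  case empty
  show ?case by (simp add: L2_set_0')
next
  case (insert \<pi> P)
  thus ?case
    using L2_set_triangle_ineq[of "\<lambda>k. g k \<pi>" "\<lambda>k. \<Sum>\<pi>\<in>P. g k \<pi>" K] by simp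
qed

text \<open>Minkowski's inequality for the finite average; it serves to pull the mean over
  \<open>\<pi>\<close> inside the Euclidean norm.\<close>

lemma L2_set_perm_mean_le:
  "L2_set (\<lambda>k. perm_mean n (g k)) K \<le> perm_mean n (\<lambda>\<pi>. L2_set (\<lambda>k. g k \<pi>) K)"
proof -
  have "L2_set (\<lambda>k. perm_mean n (g k)) K
    = (1 / fact n) * L2_set (\<lambda>k. \<Sum>\<pi> | \<pi> permutes {1..n}. g k \<pi>) K"
    by (subst L2_set_right_distrib) (simp_all add: perm_mean_def)
  also have "\<dots> \<le> (1 / fact n) * (\<Sum>\<pi> | \<pi> permutes {1..n}. L2_set (\<lambda>k. g k \<pi>) K)"
    by (intro mult_left_mono L2_set_sum_le finite_permutations) auto
  finally show ?thesis by (simp add: perm_mean_def)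
qed

section \<open>Random blocks and their norms\<close>

definition block_ind :: "nat \<Rightarrow> nat \<Rightarrow> nat \<Rightarrow> real" where
  "block_ind n k j = (if real j \<le> real n / real k then 1 else 0)"

lemma block_ind_nonneg: "0 \<le> block_ind n k j"
  by (simp add: block_ind_def)

lemma cvec_eq_block_ind: "cvec n a k j = a k * block_ind n k j"
  by (simp add: cvec_def block_ind_def)

lemma sum_block_ind:
  assumes "k \<ge> 1"
  shows "(\<Sum>j=1..n. block_ind n k j) = real (n div k)"
proof -
  have iff: "real j \<le> real n / real k \<longleftrightarrow> j \<le> n div k" for j
  proof -
    have "real j \<le> real n / real k \<longleftrightarrow> real (j * k) \<le> real n"
      using assms by (simp add: field_simps)
    thus ?thesis using assms by (simp only: of_nat_le_iff less_eq_div_iff_mult_less_eq)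
  qed
  have "(\<Sum>j=1..n. block_ind n k j) = (\<Sum>j\<in>{j\<in>{1..n}. j \<le> n div k}. 1)"
    unfolding block_ind_def iff by (simp add: sum.If_cases Int_def)
  also have "{j\<in>{1..n}. j \<le> n div k} = {1..n div k}"
    by (auto intro: le_trans[OF _ div_le_dividend])
  finally show ?thesis by simp
qed

text \<open>Since \<open>k \<le> n\<close>, the quotient \<open>n div k\<close> is at least 1, so
  the remainder is less than \<open>k * (n div k)\<close> and rounding costs at most a factor
  2.\<close>

lemma block_density:
  assumes "k \<in> {1..n}"
  shows "real (n div k) / n \<le> 1 / k" "1 / (2 * real k) \<le> real (n div k) / n"
proof -
  show "real (n div k) / n \<le> 1 / k"
  proof -
    have "real (n div k * k) \<le> real n" by (simp only: of_nat_le_iff div_times_less_eq_dividend)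
    thus "real (n div k) / n \<le> 1 / k" using assms by (simp add: field_simps)
  qed
  have "n = k * (n div k) + n mod k" by simp
  moreover have "n mod k < k" using assms by simp
  moreover have "k * 1 \<le> k * (n div k)" using assms by (intro mult_le_mono2) (simp add: div_greater_zero_iff Suc_leI)
  ultimately have "n \<le> 2 * (k * (n div k))" by linarith
  hence "real n \<le> real (2 * (k * (n div k)))" by (simp only: of_nat_le_iff)
  thus "1 / (2 * real k) \<le> real (n div k) / n" using assms by (simp add: field_simps)
qed

text \<open>For \<open>X = rearr n x\<close> this takes the role of
  \<open>b\<^sub>k(\<pi>) / a\<^sub>k\<close> in the overview.\<close>

definition block_norm :: "nat \<Rightarrow> (nat \<Rightarrow> real) \<Rightarrow> nat \<Rightarrow> (nat \<Rightarrow> nat) \<Rightarrow> real" where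
  "block_norm n X k \<pi> = sqrt (\<Sum>i=1..n. (X i * block_ind n k (\<pi> i))\<^sup>2)"

lemma block_norm_nonneg: "0 \<le> block_norm n X k \<pi>"
  by (simp add: block_norm_def sum_nonneg)

text \<open>Replacing \<open>x\<close> by its rearrangement amounts to composing
  \<open>\<pi>\<close> with a fixed permutation, which leaves the average unchanged; signs disappear
  in the squares.\<close>

lemma perm_average_eq_block_norm:
  "perm_average p n d a x = perm_mean n (\<lambda>\<pi>. perm_mean n (\<lambda>\<sigma>. perm_mean n (\<lambda>\<eta>.
     sqrt (\<Sum>k=1..n. (a k * block_norm n (rearr n x) k \<pi> * d (\<sigma> k) * zvec p n (\<eta> k))\<^sup>2))))"
proof -
  obtain \<tau> where \<tau>: "\<tau> permutes {1..n}" "\<And>i. i \<in> {1..n} \<Longrightarrow> rearr n x i = \<bar>x (\<tau> i)\<bar>"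
    using rearr_eq_permuted[of n x] by blast
  define f where "f \<pi> = perm_mean n (\<lambda>\<sigma>. perm_mean n (\<lambda>\<eta>.
    sqrt (\<Sum>i=1..n. \<Sum>k=1..n. \<bar>x i * cvec n a k (\<pi> i) * d (\<sigma> k) * zvec p n (\<eta> k)\<bar>\<^sup>2)))" for \<pi>
  define g where "g \<pi> = perm_mean n (\<lambda>\<sigma>. perm_mean n (\<lambda>\<eta>.
    sqrt (\<Sum>k=1..n. (a k * block_norm n (rearr n x) k \<pi> * d (\<sigma> k) * zvec p n (\<eta> k))\<^sup>2)))" for \<pi>
  have "g (\<pi> \<circ> \<tau>) = f \<pi>" for \<pi>
  proof -
    have "(\<Sum>k=1..n. (a k * block_norm n (rearr n x) k (\<pi> \<circ> \<tau>) * d (\<sigma> k) * zvec p n (\<eta> k))\<^sup>2)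
      = (\<Sum>i=1..n. \<Sum>k=1..n. \<bar>x i * cvec n a k (\<pi> i) * d (\<sigma> k) * zvec p n (\<eta> k)\<bar>\<^sup>2)" for \<sigma> \<eta>
    proof -
      have sq: "(block_norm n (rearr n x) k (\<pi> \<circ> \<tau>))\<^sup>2 = (\<Sum>i=1..n. (x i * block_ind n k (\<pi> i))\<^sup>2)" for k
      proof -
        have "(block_norm n (rearr n x) k (\<pi> \<circ> \<tau>))\<^sup>2 = (\<Sum>i=1..n. (rearr n x i * block_ind n k (\<pi> (\<tau> i)))\<^sup>2)"
          by (simp add: block_norm_def sum_nonneg)
        also have "\<dots> = (\<Sum>i=1..n. (x (\<tau> i) * block_ind n k (\<pi> (\<tau> i)))\<^sup>2)"
          using \<tau>(2) by (intro sum.cong) (simp_all add: power_mult_distrib)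
        also have "\<dots> = (\<Sum>i=1..n. (x i * block_ind n k (\<pi> i))\<^sup>2)"
          by (rule sum_permutes_apply[OF \<tau>(1)])
        finally show ?thesis .
      qed
      have "(\<Sum>k=1..n. (a k * block_norm n (rearr n x) k (\<pi> \<circ> \<tau>) * d (\<sigma> k) * zvec p n (\<eta> k))\<^sup>2)
        = (\<Sum>k=1..n. \<Sum>i=1..n. \<bar>x i * cvec n a k (\<pi> i) * d (\<sigma> k) * zvec p n (\<eta> k)\<bar>\<^sup>2)"
        by (intro sum.cong refl)
          (simp add: power_mult_distrib sq sum_distrib_left sum_distrib_right cvec_eq_block_ind mult_ac)
      thus ?thesis by (subst sum.swap) simp
    qed
    thus ?thesis by (simp only: f_def g_def)
  qed
  hence "perm_mean n f = perm_mean n g"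
    using perm_mean_compose_right[OF \<tau>(1), of g] by simp
  thus ?thesis by (simp add: perm_average_eq_perm_mean f_def[abs_def] g_def[abs_def])
qed

section \<open>Moments of the block norms\<close>

context
  fixes n k :: nat and X :: "nat \<Rightarrow> real"
  assumes k: "k \<in> {1..n}"
    and X: "\<And>i. i \<in> {1..n} \<Longrightarrow> 0 \<le> X i"
    and X_anti: "\<And>i j. i \<in> {1..n} \<Longrightarrow> j \<in> {1..n} \<Longrightarrow> i \<le> j \<Longrightarrow> X j \<le> X i"
begin

text \<open>The scaled lower bound is applied with exponent 2, weights \<open>block_ind n k\<close>
  and scale \<open>X k\<close>. Each of the first \<open>k\<close> entries is at least the scale and
  contributes at least the block density, hence \<open>1 / (2 * k)\<close>; together they reach
  \<open>1 / 2\<close>.\<close>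

lemma perm_mean_block_norm_ge: "X k / 6 \<le> perm_mean n (block_norm n X k)"
proof (cases "X k = 0")
  case True
  thus ?thesis using perm_mean_nonneg[of n "block_norm n X k"] block_norm_nonneg by simp
next
  case False
  hence Xk: "X k > 0" using X[OF k] by simp
  have nn: "0 \<le> trunc_mean 2 n (block_ind n k) (X i / X k)" if "i \<in> {1..n}" for i
    using X[OF that] Xk block_ind_nonneg by (intro trunc_mean_nonneg) auto
  have top: "real (n div k) / n \<le> trunc_mean 2 n (block_ind n k) (X i / X k)" if i: "i \<in> {1..k}" for i
  proof -
    have "X i / X k \<ge> 1" using X_anti[of i k] i k Xk by simp
    hence "(\<Sum>j=1..n. block_ind n k j) \<le> (\<Sum>j=1..n. trunc_pow 2 (X i / X k * block_ind n k j))"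
      by (intro sum_mono) (auto simp: block_ind_def trunc_pow_def)
    thus ?thesis
      using k sum_block_ind[of k n] by (simp add: trunc_mean_def divide_right_mono)
  qed
  have "1 / 2 = (\<Sum>i=1..k. 1 / (2 * real k))" using k by simp
  also have "\<dots> \<le> (\<Sum>i=1..k. real (n div k) / n)"
    using block_density(2)[OF k] by (intro sum_mono) simp
  also have "\<dots> \<le> (\<Sum>i=1..k. trunc_mean 2 n (block_ind n k) (X i / X k))"
    using top by (rule sum_mono)
  also have "\<dots> \<le> (\<Sum>i=1..n. trunc_mean 2 n (block_ind n k) (X i / X k))"
    using nn k by (intro sum_mono2) auto
  finally have "X k / 6 \<le> perm_mean n (\<lambda>\<pi>. (\<Sum>i=1..n. (X i * block_ind n k (\<pi> i)) powr 2) powr (1 / 2))"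
    using X Xk block_ind_nonneg by (intro perm_mean_lq_norm_ge_scaled) auto
  also have "\<dots> = perm_mean n (block_norm n X k)"
    unfolding block_norm_def using X block_ind_nonneg
    by (intro perm_mean_cong sqrt_sum_squares_eq_powr[symmetric] mult_nonneg_nonneg) auto
  finally show ?thesis .
qed

lemma perm_mean_weighted_block_le:
  assumes w: "\<And>i. i \<in> I \<Longrightarrow> 0 \<le> w i" and I: "I \<subseteq> {1..n}"
  shows "perm_mean n (\<lambda>\<pi>. \<Sum>i\<in>I. w i * block_ind n k (\<pi> i)) \<le> (1 / real k) * (\<Sum>i\<in>I. w i)"
proof -
  have "perm_mean n (\<lambda>\<pi>. \<Sum>i\<in>I. w i * block_ind n k (\<pi> i)) = (\<Sum>i\<in>I. w i * (real (n div k) / n))"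
    unfolding perm_mean_sum perm_mean_cmult
  proof (intro sum.cong refl)
    fix i assume "i \<in> I"
    hence "i \<in> {1..n}" using I by blast
    thus "w i * perm_mean n (\<lambda>\<pi>. block_ind n k (\<pi> i)) = w i * (real (n div k) / n)"
      using k sum_block_ind[of k n] by (subst perm_mean_apply) simp_all
  qed
  also have "\<dots> \<le> (\<Sum>i\<in>I. w i * (1 / real k))"
    using w block_density(1)[OF k] by (intro sum_mono mult_left_mono) auto
  also have "\<dots> = (1 / real k) * (\<Sum>i\<in>I. w i)" by (simp add: sum_divide_distrib)
  finally show ?thesis .
qed

text \<open>The sum of squares is cut at \<open>k\<close>. As \<open>p / 2 < 1\<close>, its power
  \<open>p / 2\<close> is subadditive: the head is split into single entries, where the indicators
  remain linear, and the tail is handled by Jensen's inequality.\<close>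

lemma perm_mean_block_norm_powr_le:
  assumes p: "1 < p" "p < 2"
  shows "perm_mean n (\<lambda>\<pi>. block_norm n X k \<pi> powr p)
    \<le> (1 / real k) * (\<Sum>i=1..k. X i powr p)
      + sqrt ((1 / real k) * (\<Sum>i=k+1..n. (X i)\<^sup>2)) powr p"
proof -
  define T where "T \<pi> = (\<Sum>i=k+1..n. (X i)\<^sup>2 * block_ind n k (\<pi> i))" for \<pi> :: "nat \<Rightarrow> nat"
  have T0: "0 \<le> T \<pi>" for \<pi> unfolding T_def by (intro sum_nonneg mult_nonneg_nonneg block_ind_nonneg) simp
  have point: "block_norm n X k \<pi> powr p
    \<le> (\<Sum>i=1..k. X i powr p * block_ind n k (\<pi> i)) + T \<pi> powr (p / 2)" for \<pi>
  proof -
    have ind2: "(block_ind n k j)\<^sup>2 = block_ind n k j" for j by (simp add: block_ind_def)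
    have "(\<Sum>i=1..n. (X i * block_ind n k (\<pi> i))\<^sup>2)
      = (\<Sum>i=1..k. (X i)\<^sup>2 * block_ind n k (\<pi> i)) + T \<pi>"
      using sum.ub_add_nat[of 1 k "\<lambda>i. (X i)\<^sup>2 * block_ind n k (\<pi> i)" "n - k"] k
      by (simp add: power_mult_distrib ind2 T_def)
    hence "block_norm n X k \<pi> powr p = ((\<Sum>i=1..k. (X i)\<^sup>2 * block_ind n k (\<pi> i)) + T \<pi>) powr (p / 2)"
      using T0 by (simp add: block_norm_def powr_half_sqrt[symmetric] powr_powr sum_nonneg block_ind_nonneg)
    also have "\<dots> \<le> (\<Sum>i=1..k. (X i)\<^sup>2 * block_ind n k (\<pi> i)) powr (p / 2) + T \<pi> powr (p / 2)"
      using T0 p by (intro powr_add_le_add_powr sum_nonneg mult_nonneg_nonneg block_ind_nonneg) auto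
    also have "(\<Sum>i=1..k. (X i)\<^sup>2 * block_ind n k (\<pi> i)) powr (p / 2)
      \<le> (\<Sum>i=1..k. ((X i)\<^sup>2 * block_ind n k (\<pi> i)) powr (p / 2))"
      using p by (intro powr_sum_le_sum_powr mult_nonneg_nonneg block_ind_nonneg) auto
    also have "\<dots> = (\<Sum>i=1..k. X i powr p * block_ind n k (\<pi> i))"
    proof (intro sum.cong refl)
      fix i assume "i \<in> {1..k}"
      hence "0 \<le> X i" using X k by simp
      hence "((X i)\<^sup>2) powr (p / 2) = X i powr p"
        by (simp add: powr_numeral[symmetric] powr_powr del: powr_numeral)
      thus "((X i)\<^sup>2 * block_ind n k (\<pi> i)) powr (p / 2) = X i powr p * block_ind n k (\<pi> i)"
        by (simp add: block_ind_def)
    qed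
    finally show ?thesis by simp
  qed
  have "perm_mean n (\<lambda>\<pi>. block_norm n X k \<pi> powr p)
    \<le> perm_mean n (\<lambda>\<pi>. (\<Sum>i=1..k. X i powr p * block_ind n k (\<pi> i)) + T \<pi> powr (p / 2))"
    using point by (rule perm_mean_mono)
  also have "\<dots> = perm_mean n (\<lambda>\<pi>. \<Sum>i=1..k. X i powr p * block_ind n k (\<pi> i))
      + perm_mean n (\<lambda>\<pi>. T \<pi> powr (p / 2))"
    by (rule perm_mean_add)
  also have "\<dots> \<le> (1 / real k) * (\<Sum>i=1..k. X i powr p)
      + ((1 / real k) * (\<Sum>i=k+1..n. (X i)\<^sup>2)) powr (p / 2)"
  proof (rule add_mono)
    show "perm_mean n (\<lambda>\<pi>. \<Sum>i=1..k. X i powr p * block_ind n k (\<pi> i)) \<le> (1 / real k) * (\<Sum>i=1..k. X i powr p)"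
      using k by (intro perm_mean_weighted_block_le) auto
    have "perm_mean n (\<lambda>\<pi>. T \<pi> powr (p / 2))
      \<le> perm_mean n (\<lambda>\<pi>. (T \<pi> powr (p / 2)) powr (2 / p)) powr (1 / (2 / p))"
      using p by (intro perm_mean_le_powr) auto
    also have "\<dots> = perm_mean n T powr (p / 2)"
      using p T0 by (simp add: powr_powr)
    also have "\<dots> \<le> ((1 / real k) * (\<Sum>i=k+1..n. (X i)\<^sup>2)) powr (p / 2)"
    proof (rule powr_mono2)
      show "perm_mean n T \<le> (1 / real k) * (\<Sum>i=k+1..n. (X i)\<^sup>2)"
        unfolding T_def by (intro perm_mean_weighted_block_le) auto
    qed (use p T0 perm_mean_nonneg in auto)
    finally show "perm_mean n (\<lambda>\<pi>. T \<pi> powr (p / 2)) \<le> ((1 / real k) * (\<Sum>i=k+1..n. (X i)\<^sup>2)) powr (p / 2)" .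
  qed
  also have "((1 / real k) * (\<Sum>i=k+1..n. (X i)\<^sup>2)) powr (p / 2)
    = sqrt ((1 / real k) * (\<Sum>i=k+1..n. (X i)\<^sup>2)) powr p"
    by (simp add: powr_half_sqrt[symmetric] powr_powr sum_nonneg)
  finally show ?thesis .
qed

end

text \<open>The upper bound is expressed through the norms of \<open>u\<close> and \<open>v\<close>,
  the vectors that the hypotheses of the theorem control.\<close>

lemma perm_average_bounds:
  fixes C1 C2 A B p :: real and n :: nat and a d x :: "nat \<Rightarrow> real" and M :: "real \<Rightarrow> real"
  defines "u \<equiv> \<lambda>k. ((1 / real k) * (\<Sum>i=1..k. \<bar>rearr n x i\<bar> powr p)) powr (1 / p)"
    and "v \<equiv> \<lambda>k. sqrt ((1 / real k) * (\<Sum>i=k+1..n. \<bar>rearr n x i\<bar>\<^sup>2))"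
  assumes A: "A > 0" and B: "B > 0" and p: "1 < p" "p < 2" and n: "n \<ge> 1"
    and d_anti: "antimono_on {1..n} d" and d_pos: "\<And>i. i \<in> {1..n} \<Longrightarrow> d i > 0"
    and a_pos: "\<And>i. i \<in> {1..n} \<Longrightarrow> a i > 0"
    and rel: "orlicz_related A B p n d M"
  shows "orlicz_lorentz_norm n M a x \<le> 5184 * B * perm_average p n d a x"
    and "perm_average p n d a x
      \<le> (1 + zconst p) * (10 / A) * (orlicz_lorentz_norm n M a u + orlicz_lorentz_norm n M a v)"
proof -
  define X where "X = rearr n x"
  have X: "0 \<le> X i" if "i \<in> {1..n}" for i
    using that by (simp add: X_def rearr_nonneg)
  have X_anti: "X j \<le> X i" if "i \<in> {1..n}" "j \<in> {1..n}" "i \<le> j" for i j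
    using that unfolding X_def by (rule rearr_antimono)
  define z where "z = zvec p n"
  have z: "0 \<le> z j" for j by (simp add: z_def zvec_nonneg)
  define s where "s = block_norm n X"
  have s: "0 \<le> s k \<pi>" for k \<pi> by (simp add: s_def block_norm_nonneg)
  define N where "N b = perm_mean n (\<lambda>\<sigma>. (\<Sum>k=1..n. (a k * b k * d (\<sigma> k)) powr p) powr (1 / p))"
    for b :: "nat \<Rightarrow> real"
  have d0: "0 \<le> d (\<sigma> k)" if "\<sigma> permutes {1..n}" "k \<in> {1..n}" for \<sigma> k
    using d_pos[of "\<sigma> k"] permutes_in_image[OF that(1), of k] that(2) by simp
  have avg: "perm_average p n d a x = perm_mean n (\<lambda>\<pi>. perm_mean n (\<lambda>\<sigma>. perm_mean n (\<lambda>\<eta>.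
     sqrt (\<Sum>k=1..n. (a k * s k \<pi> * d (\<sigma> k) * z (\<eta> k))\<^sup>2))))"
    by (simp add: perm_average_eq_block_norm s_def X_def z_def)

  \<comment> \<open>The mean over \<open>\<pi>\<close> is made innermost, so that Minkowski's
    inequality can move it onto the single block norms.\<close>
  have "perm_average p n d a x = perm_mean n (\<lambda>\<sigma>. perm_mean n (\<lambda>\<eta>. perm_mean n (\<lambda>\<pi>.
     sqrt (\<Sum>k=1..n. (a k * s k \<pi> * d (\<sigma> k) * z (\<eta> k))\<^sup>2))))"
    unfolding avg by (subst perm_mean_swap, subst (2) perm_mean_swap) (rule refl)
  also have "\<dots> \<ge> perm_mean n (\<lambda>\<sigma>. perm_mean n (\<lambda>\<eta>.
     1 / 6 * sqrt (\<Sum>k=1..n. (a k * X k * d (\<sigma> k) * z (\<eta> k))\<^sup>2)))"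
  proof (intro perm_mean_mono)
    fix \<sigma> \<eta> :: "nat \<Rightarrow> nat" assume \<sigma>: "\<sigma> permutes {1..n}"
    define w where "w k = a k * d (\<sigma> k) * z (\<eta> k)" for k
    have w: "0 \<le> w k" if "k \<in> {1..n}" for k
      unfolding w_def using that by (intro mult_nonneg_nonneg less_imp_le[OF a_pos] d0[OF \<sigma>] z)
    have "1 / 6 * sqrt (\<Sum>k=1..n. (a k * X k * d (\<sigma> k) * z (\<eta> k))\<^sup>2)
      = 1 / 6 * L2_set (\<lambda>k. w k * X k) {1..n}"
      by (simp add: L2_set_def w_def mult_ac)
    also have "\<dots> = L2_set (\<lambda>k. w k * (X k / 6)) {1..n}"
      by (subst L2_set_right_distrib) (simp_all add: mult_ac)
    also have "\<dots> \<le> L2_set (\<lambda>k. perm_mean n (\<lambda>\<pi>. w k * s k \<pi>)) {1..n}"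
      unfolding perm_mean_cmult s_def using w X
      by (intro L2_set_mono mult_left_mono perm_mean_block_norm_ge mult_nonneg_nonneg X_anti) auto
    also have "\<dots> \<le> perm_mean n (\<lambda>\<pi>. L2_set (\<lambda>k. w k * s k \<pi>) {1..n})"
      by (rule L2_set_perm_mean_le)
    also have "\<dots> = perm_mean n (\<lambda>\<pi>. sqrt (\<Sum>k=1..n. (a k * s k \<pi> * d (\<sigma> k) * z (\<eta> k))\<^sup>2))"
      by (simp add: L2_set_def w_def mult_ac)
    finally show "1 / 6 * sqrt (\<Sum>k=1..n. (a k * X k * d (\<sigma> k) * z (\<eta> k))\<^sup>2) \<le> \<dots>" .
  qed
  finally have low1: "1 / 6 * perm_mean n (\<lambda>\<sigma>. perm_mean n (\<lambda>\<eta>.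
     sqrt (\<Sum>k=1..n. (a k * X k * d (\<sigma> k) * z (\<eta> k))\<^sup>2))) \<le> perm_average p n d a x"
    by (simp only: perm_mean_cmult)
  have "N X \<le> perm_mean n (\<lambda>\<sigma>. 12 * perm_mean n (\<lambda>\<eta>.
     sqrt (\<Sum>k=1..n. (a k * X k * d (\<sigma> k) * z (\<eta> k))\<^sup>2)))"
    unfolding N_def z_def using p n X d0 less_imp_le[OF a_pos]
    by (intro perm_mean_mono perm_mean_zvec_ge mult_nonneg_nonneg) auto
  \<comment> \<open>The factor is \<open>6 * 12\<close>, from the block norms and from the weights
    \<open>z\<close>. A further \<open>72 * B\<close> from the Orlicz comparison leads to
    5184.\<close>
  hence "N X \<le> 72 * perm_average p n d a x"
    using low1 by (simp add: perm_mean_cmult)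
  moreover have "orlicz_lorentz_norm n M a x \<le> 72 * B * N X"
    unfolding N_def X_def using less_imp_le[OF a_pos] rearr_nonneg
    by (intro orlicz_lorentz_norm_le_perm_mean[OF A B p(1) n d_anti d_pos rel] mult_nonneg_nonneg) auto
  moreover have "72 * B * N X \<le> 72 * B * (72 * perm_average p n d a x)"
    using calculation(1) B by (intro mult_left_mono) auto
  ultimately show "orlicz_lorentz_norm n M a x \<le> 5184 * B * perm_average p n d a x"
    by simp

  have absX: "\<bar>rearr n x i\<bar> = X i" if "i \<in> {1..n}" for i
    using X[OF that] by (simp add: X_def)
  have u_eq: "u k = ((1 / real k) * (\<Sum>i=1..k. X i powr p)) powr (1 / p)" if "k \<in> {1..n}" for k
    unfolding u_def using that absX by (intro arg_cong2[of _ _ _ _ "(powr)"] arg_cong2[of _ _ _ _ "(*)"] sum.cong) auto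
  have v_eq: "v k = sqrt ((1 / real k) * (\<Sum>i=k+1..n. (X i)\<^sup>2))" for k
    by (simp add: v_def X_def)
  have u0: "0 \<le> u k" and v0: "0 \<le> v k" for k
    by (simp_all add: u_def v_def sum_nonneg)
  have u_rearr: "rearr n u k = u k" if k: "k \<in> {1..n}" for k
  proof (rule rearr_eq_self[OF u0 _ k])
    fix i j assume ij: "i \<in> {1..n}" "j \<in> {1..n}" "i \<le> j"
    show "u j \<le> u i"
      unfolding u_eq[OF ij(1)] u_eq[OF ij(2)] using ij p X X_anti
      by (intro powr_mono2 initial_average_antimono[where n = n] mult_nonneg_nonneg sum_nonneg) auto
  qed
  have v_rearr: "rearr n v k = v k" if k: "k \<in> {1..n}" for k
  proof (rule rearr_eq_self[OF v0 _ k])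
    fix i j assume "i \<in> {1..n}" "j \<in> {1..n}" "i \<le> j"
    thus "v j \<le> v i"
      unfolding v_eq by (intro real_sqrt_le_mono tail_average_antimono) auto
  qed
  have N_le: "N b \<le> 10 / A * orlicz_lorentz_norm n M a b"
    if "\<And>k. 0 \<le> b k" "\<And>k. k \<in> {1..n} \<Longrightarrow> rearr n b k = b k" for b
  proof -
    have "N b = perm_mean n (\<lambda>\<sigma>. (\<Sum>k=1..n. (a k * rearr n b k * d (\<sigma> k)) powr p) powr (1 / p))"
      unfolding N_def using that by (intro perm_mean_cong arg_cong2[of _ _ _ _ "(powr)"] sum.cong) auto
    also have "\<dots> \<le> 10 / A * orlicz_lorentz_norm n M a b"
      using less_imp_le[OF a_pos] rearr_nonneg
      by (intro perm_mean_le_orlicz_lorentz_norm[OF A B p(1) n d_anti d_pos rel] mult_nonneg_nonneg) auto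
    finally show ?thesis .
  qed
  have block: "perm_mean n (\<lambda>\<pi>. s k \<pi> powr p) \<le> u k powr p + v k powr p" if k: "k \<in> {1..n}" for k
    using perm_mean_block_norm_powr_le[OF k X X_anti p] p
    by (simp add: u_eq[OF k] v_eq s_def powr_powr sum_nonneg)
  \<comment> \<open>For fixed \<open>\<pi>\<close> and \<open>\<sigma>\<close> the mean over
    \<open>\<eta>\<close> is replaced by an lp norm.\<close>
  have "perm_average p n d a x \<le> perm_mean n (\<lambda>\<pi>. perm_mean n (\<lambda>\<sigma>.
      (1 + zconst p) * (\<Sum>k=1..n. (a k * s k \<pi> * d (\<sigma> k)) powr p) powr (1 / p)))"
    unfolding avg z_def using p n s d0 less_imp_le[OF a_pos]
    by (intro perm_mean_mono perm_mean_zvec_le mult_nonneg_nonneg) auto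
  also have "\<dots> = (1 + zconst p) * perm_mean n (\<lambda>\<sigma>. perm_mean n (\<lambda>\<pi>.
      (\<Sum>k=1..n. (a k * s k \<pi> * d (\<sigma> k)) powr p) powr (1 / p)))"
    unfolding perm_mean_cmult by (subst perm_mean_swap) (rule refl)
  also have "\<dots> \<le> (1 + zconst p) * perm_mean n (\<lambda>\<sigma>.
      (\<Sum>k=1..n. (a k * u k * d (\<sigma> k)) powr p) powr (1 / p)
      + (\<Sum>k=1..n. (a k * v k * d (\<sigma> k)) powr p) powr (1 / p))"
  proof (intro mult_left_mono perm_mean_mono)
    fix \<sigma> :: "nat \<Rightarrow> nat" assume \<sigma>: "\<sigma> permutes {1..n}"
    have pw: "(a k * b * d (\<sigma> k)) powr p = (a k * d (\<sigma> k)) powr p * b powr p"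
      if "k \<in> {1..n}" "0 \<le> b" for k b
      using that d0[OF \<sigma> that(1)] a_pos[OF that(1)] by (simp add: powr_mult mult_ac)
    \<comment> \<open>The p-th power of the lp norm is linear in the powers of the block norms, so
      after Jensen's inequality the mean over \<open>\<pi>\<close> acts on each
      \<open>s k \<pi> powr p\<close> separately.\<close>
    have "perm_mean n (\<lambda>\<pi>. (\<Sum>k=1..n. (a k * s k \<pi> * d (\<sigma> k)) powr p) powr (1 / p))
      \<le> perm_mean n (\<lambda>\<pi>. ((\<Sum>k=1..n. (a k * s k \<pi> * d (\<sigma> k)) powr p) powr (1 / p)) powr p) powr (1 / p)"
      using p by (intro perm_mean_le_powr) auto
    also have "\<dots> = perm_mean n (\<lambda>\<pi>. \<Sum>k=1..n. (a k * s k \<pi> * d (\<sigma> k)) powr p) powr (1 / p)"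
      using p by (simp add: powr_powr sum_nonneg)
    also have "perm_mean n (\<lambda>\<pi>. \<Sum>k=1..n. (a k * s k \<pi> * d (\<sigma> k)) powr p)
      = (\<Sum>k=1..n. (a k * d (\<sigma> k)) powr p * perm_mean n (\<lambda>\<pi>. s k \<pi> powr p))"
      unfolding perm_mean_sum perm_mean_cmult[symmetric]
      using s by (intro sum.cong perm_mean_cong) (simp_all add: pw)
    also have "\<dots> powr (1 / p) \<le> (\<Sum>k=1..n. (a k * d (\<sigma> k)) powr p * (u k powr p + v k powr p)) powr (1 / p)"
      using p block by (intro powr_mono2 sum_mono mult_left_mono sum_nonneg mult_nonneg_nonneg perm_mean_nonneg) auto
    also have "(\<Sum>k=1..n. (a k * d (\<sigma> k)) powr p * (u k powr p + v k powr p))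
      = (\<Sum>k=1..n. (a k * u k * d (\<sigma> k)) powr p) + (\<Sum>k=1..n. (a k * v k * d (\<sigma> k)) powr p)"
      unfolding sum.distrib[symmetric] using u0 v0 by (intro sum.cong) (simp_all add: pw distrib_left)
    also have "\<dots> powr (1 / p) \<le> (\<Sum>k=1..n. (a k * u k * d (\<sigma> k)) powr p) powr (1 / p)
      + (\<Sum>k=1..n. (a k * v k * d (\<sigma> k)) powr p) powr (1 / p)"
      using p by (intro powr_add_le_add_powr sum_nonneg) auto
    finally show "perm_mean n (\<lambda>\<pi>. (\<Sum>k=1..n. (a k * s k \<pi> * d (\<sigma> k)) powr p) powr (1 / p)) \<le> \<dots>" .
  qed (use zconst_pos[OF p] in simp)
  also have "\<dots> = (1 + zconst p) * (N u + N v)"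
    by (simp only: perm_mean_add N_def)
  also have "\<dots> \<le> (1 + zconst p) * (10 / A * orlicz_lorentz_norm n M a u + 10 / A * orlicz_lorentz_norm n M a v)"
    using zconst_pos[OF p] by (intro mult_left_mono add_mono N_le u0 v0 u_rearr v_rearr) auto
  finally show "perm_average p n d a x
      \<le> (1 + zconst p) * (10 / A) * (orlicz_lorentz_norm n M a u + orlicz_lorentz_norm n M a v)"
    by (simp only: distrib_left mult.assoc)
qed

theorem theorem3p1:
  fixes C1 C2 A B p :: real
  assumes "C1 > 0" and "C2 > 0" and "A > 0" and "B > 0" and "1 < p" and "p < 2"
  shows "\<exists>c1 c2 :: real. c1 > 0 \<and> c2 > 0 \<and>
    (\<forall>(n::nat) (d :: nat \<Rightarrow> real) (a :: nat \<Rightarrow> real) (M :: real \<Rightarrow> real).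
       n \<ge> 1 \<longrightarrow>
       antimono_on {1..n} d \<longrightarrow> (\<forall>i\<in>{1..n}. d i > 0) \<longrightarrow>
       antimono_on {1..n} a \<longrightarrow> (\<forall>i\<in>{1..n}. a i > 0) \<longrightarrow>
       orlicz_related A B p n d M \<longrightarrow>
       (\<forall>x :: nat \<Rightarrow> real.
          orlicz_lorentz_norm n M a
            (\<lambda>k. ((1 / real k) * (\<Sum>i=1..k. \<bar>rearr n x i\<bar> powr p)) powr (1 / p))
          \<le> C1 * orlicz_lorentz_norm n M a x) \<longrightarrow>
       (\<forall>x :: nat \<Rightarrow> real.
          orlicz_lorentz_norm n M a
            (\<lambda>k. sqrt ((1 / real k) * (\<Sum>i=k+1..n. \<bar>rearr n x i\<bar>\<^sup>2)))
          \<le> C2 * orlicz_lorentz_norm n M a x) \<longrightarrow>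
       (\<forall>x :: nat \<Rightarrow> real.
          c1 * orlicz_lorentz_norm n M a x \<le> perm_average p n d a x \<and>
          perm_average p n d a x \<le> c2 * orlicz_lorentz_norm n M a x))"
proof (intro exI conjI allI impI)
  \<comment> \<open>Both constants involve only \<open>p\<close> and the fixed \<open>A\<close>,
    \<open>B\<close>, \<open>C1\<close>, \<open>C2\<close>; \<open>C1 + C2\<close> arises from the
    norms of the two vectors of averages.\<close>
  let ?c1 = "1 / (5184 * B)" and ?c2 = "(1 + zconst p) * (10 / A) * (C1 + C2)"
  have K: "0 < (1 + zconst p) * (10 / A)"
    using zconst_pos[of p] assms by (intro mult_pos_pos) auto
  show "?c1 > 0" using assms by simp
  show "?c2 > 0" using K assms by (intro mult_pos_pos[OF K]) simp
  fix n :: nat and d a :: "nat \<Rightarrow> real" and M :: "real \<Rightarrow> real" and x :: "nat \<Rightarrow> real"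
  assume n: "n \<ge> 1" and d: "antimono_on {1..n} d" "\<forall>i\<in>{1..n}. d i > 0"
    and a: "antimono_on {1..n} a" "\<forall>i\<in>{1..n}. a i > 0"
    and rel: "orlicz_related A B p n d M"
    and h1: "\<forall>x :: nat \<Rightarrow> real. orlicz_lorentz_norm n M a
        (\<lambda>k. ((1 / real k) * (\<Sum>i=1..k. \<bar>rearr n x i\<bar> powr p)) powr (1 / p))
      \<le> C1 * orlicz_lorentz_norm n M a x"
    and h2: "\<forall>x :: nat \<Rightarrow> real. orlicz_lorentz_norm n M a
        (\<lambda>k. sqrt ((1 / real k) * (\<Sum>i=k+1..n. \<bar>rearr n x i\<bar>\<^sup>2)))
      \<le> C2 * orlicz_lorentz_norm n M a x"
  have dp: "\<And>i. i \<in> {1..n} \<Longrightarrow> d i > 0" and ap: "\<And>i. i \<in> {1..n} \<Longrightarrow> a i > 0"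
    using d a by blast+
  note bounds = perm_average_bounds[OF assms(3-6) n d(1) dp ap rel, where x = x]
  have "1 / (5184 * B) * orlicz_lorentz_norm n M a x
    \<le> 1 / (5184 * B) * (5184 * B * perm_average p n d a x)"
    using bounds(1) assms(4) by (intro mult_left_mono) auto
  thus "?c1 * orlicz_lorentz_norm n M a x \<le> perm_average p n d a x"
    using assms(4) by simp
  have "perm_average p n d a x \<le> (1 + zconst p) * (10 / A) *
      (C1 * orlicz_lorentz_norm n M a x + C2 * orlicz_lorentz_norm n M a x)"
    using h1[rule_format, of x] h2[rule_format, of x] K
    by (intro order_trans[OF bounds(2)] mult_left_mono add_mono) auto
  thus "perm_average p n d a x \<le> ?c2 * orlicz_lorentz_norm n M a x"
    by (simp only: distrib_right mult.assoc)
qed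

end
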